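(* Let $k,\ell\ge2$ be coprime integers, and let $\mathbf a\in\mathbb Z^{\mathbb N_0}$ be a sequence that is both $k$-regular and asymptotically $\ell$-regular. Then $\mathbf a\simeq\mathbf a'$ for some $k$-regular sequence $\mathbf a'\in\mathbb Z^{\mathbb N_0}$ that satisfies a linear recurrence, i.e. there exist $d\in\mathbb N$ and $t_1,\dots,t_d\in\mathbb Z$ with $a'_{n+d}=t_1a'_{n+d-1}+\dots+t_da'_n$ for all $n\in\mathbb N_0$.
   Context: For an integer $k\ge2$ and $\mathbf a=(a_n)_{n\ge0}\in\mathbb Z^{\mathbb N_0}$, the $k$-kernel is $\mathcal N_k(\mathbf a)=\{(a_{k^in+r})_{n=0}^\infty: i,r\in\mathbb N_0,\ r<k^i\}$ and $\mathcal M_k(\mathbf a)$ is the $\mathbb Z$-module (under pointwise operations) generated by $\mathcal N_k(\mathbf a)$. $\mathbf a$ is $k$-regular if $\mathcal M_k(\mathbf a)$ is finitely generated. Two sequences are asymptotically equal, $\mathbf a\simeq\mathbf b$, if $\frac1N\#\{0\le n<N:a_n\ne b_n\}\to0$. $\mathbf a$ is asymptotically $k$-regular if $\mathcal M_k(\mathbf a)/{\simeq}$ (the quotient by the submodule of sequences asymptotically equal to $0$) is finitely generated, equivalently there exist finitely many sequences $\mathbf a^{(0)},\dots,\mathbf a^{(d-1)}$ such that every $\mathbf b\in\mathcal M_k(\mathbf a)$ satisfies $\mathbf b\simeq t_0\mathbf a^{(0)}+\dots+t_{d-1}\mathbf a^{(d-1)}$ for some $t_j\in\mathbb Z$. *)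

theory Defs
  imports Complex_Main "HOL-Library.Function_Algebras"
begin

text \<open>Integer sequences form a \<open>\<int>\<close>-module under the pointwise operations; addition is the
  one on functions from \<^theory>\<open>HOL-Library.Function_Algebras\<close>.\<close>

definition seq_scale :: "int \<Rightarrow> (nat \<Rightarrow> int) \<Rightarrow> (nat \<Rightarrow> int)"
  where "seq_scale c a = (\<lambda>n. c * a n)"

global_interpretation int_seq: module seq_scale
  by unfold_locales (auto simp: seq_scale_def fun_eq_iff algebra_simps)

definition k_kernel :: "nat \<Rightarrow> (nat \<Rightarrow> int) \<Rightarrow> (nat \<Rightarrow> int) set"
  where "k_kernel k a = {(\<lambda>n. a (k ^ i * n + r)) | i r. r < k ^ i}"

definition k_kernel_module :: "nat \<Rightarrow> (nat \<Rightarrow> int) \<Rightarrow> (nat \<Rightarrow> int) set"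
  where "k_kernel_module k a = int_seq.span (k_kernel k a)"

definition k_regular :: "nat \<Rightarrow> (nat \<Rightarrow> int) \<Rightarrow> bool"
  where "k_regular k a \<longleftrightarrow> (\<exists>G. finite G \<and> int_seq.span G = k_kernel_module k a)"

definition asymp_eq :: "(nat \<Rightarrow> int) \<Rightarrow> (nat \<Rightarrow> int) \<Rightarrow> bool"  (infix "\<simeq>" 50)
  where "a \<simeq> b \<longleftrightarrow> (\<lambda>N. real (card {n. n < N \<and> a n \<noteq> b n}) / real N) \<longlonglongrightarrow> 0"

text \<open>For a submodule \<open>M\<close>, the classes of \<open>asymp_rel M\<close> are the cosets in \<open>M\<close> of the
  submodule of sequences that are asymptotically equal to \<open>0\<close>.\<close>

definition asymp_rel :: "(nat \<Rightarrow> int) set \<Rightarrow> ((nat \<Rightarrow> int) \<times> (nat \<Rightarrow> int)) set"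
  where "asymp_rel M = {(b, c). b \<in> M \<and> c \<in> M \<and> b \<simeq> c}"

text \<open>For \<open>G \<subseteq> M\<close>, the set \<open>int_seq.span G // asymp_rel M\<close> is the image of the span of \<open>G\<close>
  under the projection to \<open>M // asymp_rel M\<close>, that is, the submodule of the quotient generated by
  the classes of the elements of \<open>G\<close>.\<close>

definition asymp_k_regular :: "nat \<Rightarrow> (nat \<Rightarrow> int) \<Rightarrow> bool"
  where "asymp_k_regular k a \<longleftrightarrow>
    (\<exists>G. finite G \<and> G \<subseteq> k_kernel_module k a \<and>
      int_seq.span G // asymp_rel (k_kernel_module k a) =
      k_kernel_module k a // asymp_rel (k_kernel_module k a))"

definition satisfies_linear_recurrence :: "(nat \<Rightarrow> int) \<Rightarrow> bool"
  where "satisfies_linear_recurrence a \<longleftrightarrow>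
    (\<exists>d\<ge>1. \<exists>t :: nat \<Rightarrow> int. \<forall>n. a (n + d) = (\<Sum>i = 1..d. t i * a (n + d - i)))"

lemma asymp_eq_refl: "a \<simeq> a"
  by (simp add: asymp_eq_def)

lemma asymp_eq_sym: "a \<simeq> b \<Longrightarrow> b \<simeq> a"
  by (simp add: asymp_eq_def eq_commute)

lemma asymp_eq_trans:
  assumes "a \<simeq> b" "b \<simeq> c"
  shows "a \<simeq> c"
proof -
  let ?D = "\<lambda>x y N. card {n. n < N \<and> x n \<noteq> (y n :: int)}"
  have "?D a c N \<le> ?D a b N + ?D b c N" for N
    by (rule order.trans[OF card_mono card_Un_le]) auto
  then have le: "real (?D a c N) / real N
      \<le> real (?D a b N) / real N + real (?D b c N) / real N" for N
    unfolding add_divide_distrib[symmetric] by (intro divide_right_mono) (auto simp flip: of_nat_add)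
  have lim: "(\<lambda>N. real (?D a b N) / real N + real (?D b c N) / real N) \<longlonglongrightarrow> 0"
    using tendsto_add[OF assms[unfolded asymp_eq_def]] by simp
  show ?thesis
    unfolding asymp_eq_def
    by (rule tendsto_sandwich[OF _ _ tendsto_const lim]) (auto simp: le)
qed

lemma equiv_asymp_rel: "equiv M (asymp_rel M)"
  by (rule equivI)
    (auto simp: asymp_rel_def refl_on_def sym_def trans_def
      intro: asymp_eq_refl asymp_eq_sym asymp_eq_trans)

lemma asymp_k_regular_iff:
  "asymp_k_regular k a \<longleftrightarrow>
    (\<exists>G. finite G \<and> G \<subseteq> k_kernel_module k a \<and>
      (\<forall>b\<in>k_kernel_module k a. \<exists>c\<in>int_seq.span G. b \<simeq> c))"
proof -
  define M where "M = k_kernel_module k a"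
  have "int_seq.span G // asymp_rel M = M // asymp_rel M \<longleftrightarrow>
      (\<forall>b\<in>M. \<exists>c\<in>int_seq.span G. b \<simeq> c)" if "G \<subseteq> M" for G
  proof -
    have sub: "int_seq.span G \<subseteq> M"
      using that int_seq.span_minimal int_seq.subspace_span
      unfolding M_def k_kernel_module_def by blast
    have cls: "asymp_rel M `` {b} = asymp_rel M `` {c} \<longleftrightarrow> b \<simeq> c" if "b \<in> M" "c \<in> M" for b c
      using eq_equiv_class_iff[OF equiv_asymp_rel that] that by (simp add: asymp_rel_def)
    show ?thesis
    proof
      assume eq: "int_seq.span G // asymp_rel M = M // asymp_rel M"
      show "\<forall>b\<in>M. \<exists>c\<in>int_seq.span G. b \<simeq> c"
      proof
        fix b assume b: "b \<in> M"
        then have "asymp_rel M `` {b} \<in> int_seq.span G // asymp_rel M"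
          unfolding eq by (rule quotientI)
        then obtain c where c: "c \<in> int_seq.span G" "asymp_rel M `` {b} = asymp_rel M `` {c}"
          by (rule quotientE)
        then show "\<exists>c\<in>int_seq.span G. b \<simeq> c"
          using cls b sub by blast
      qed
    next
      assume H: "\<forall>b\<in>M. \<exists>c\<in>int_seq.span G. b \<simeq> c"
      show "int_seq.span G // asymp_rel M = M // asymp_rel M"
      proof
        show "int_seq.span G // asymp_rel M \<subseteq> M // asymp_rel M"
          using sub by (auto simp: quotient_def)
        show "M // asymp_rel M \<subseteq> int_seq.span G // asymp_rel M"
        proof
          fix X assume "X \<in> M // asymp_rel M"
          then obtain b where b: "b \<in> M" "X = asymp_rel M `` {b}"
            by (rule quotientE)
          with H obtain c where "c \<in> int_seq.span G" "b \<simeq> c"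
            by blast
          then show "X \<in> int_seq.span G // asymp_rel M"
            using b cls sub quotientI by (metis subsetD)
        qed
      qed
    qed
  qed
  then show ?thesis
    unfolding asymp_k_regular_def M_def by blast
qed

end

theory Submission
  imports Defs "HOL-Number_Theory.Cong" "HOL-Computational_Algebra.Fundamental_Theorem_Algebra"
begin

text \<open>Let \<open>S\<close> be the shift. Among sufficiently many sequences \<open>a(l\<^sup>j n + \<rho> + \<sigma> h)\<close>, \<open>h = 0, 1, \<dots>\<close>, there
  is a linear relation modulo \<open>\<simeq>\<close>, valid along one residue class modulo \<open>l\<^sup>j\<close>. As \<open>k\<close> and \<open>l\<close> are coprime
  and the module generated by the \<open>k\<close>-kernel is Noetherian, the relation spreads to a residue class
  modulo a fixed \<open>q\<^sub>0\<close>, so every sequence in that module is annihilated, up to \<open>\<simeq>\<close>, by a nonzero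
  polynomial in \<open>S\<close>. A common annihilator \<open>P\<close> of minimal degree divides \<open>P(X\<^sup>k)\<close>, hence its roots are
  roots of unity, and \<open>(S\<^sup>q - 1)\<^sup>m a \<simeq> 0\<close> for some \<open>q\<close> and \<open>m\<close>.

  By induction on \<open>m\<close>, subtracting antidifferences, it suffices to treat \<open>a(n + 1) \<simeq> a(n)\<close>. Then \<open>a\<close> is
  constant on most blocks \<open>[k\<^sup>s n, k\<^sup>s (n + 1))\<close>. If \<open>u = k\<^sup>i / l\<^sup>j\<close> is close to \<open>1\<close>, comparing values on these
  blocks gives \<open>a(k\<^sup>i n) \<simeq> a(l\<^sup>j n)\<close>, hence the same for all powers \<open>u\<^sup>t\<close>; these connect any two
  blocks of the same scale, and \<open>a\<close> is asymptotically constant. Thus \<open>a\<close> is asymptotically a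
  quasi-polynomial.\<close>

section \<open>Sets of density zero\<close>

text \<open>Density zero, with an additive constant in place of a limit: initial segments never
  matter, and bounds for unions and affine preimages become plain arithmetic.
  \<open>asymp_eq_iff_null\<close> is the link to \<open>\<simeq>\<close>.\<close>

definition null :: "nat set \<Rightarrow> bool"
  where "null Z \<longleftrightarrow> (\<forall>e>0. \<exists>C. \<forall>N. real (card (Z \<inter> {..<N})) \<le> e * real N + C)"

lemma null_subset:
  assumes "null B" "A \<subseteq> B"
  shows "null A"
proof -
  have "real (card (A \<inter> {..<N})) \<le> real (card (B \<inter> {..<N}))" for N
    using assms(2) by (intro of_nat_mono card_mono) auto
  then show ?thesis
    using assms(1) unfolding null_def by (meson order_trans)
qed

lemma null_empty: "null {}"
  unfolding null_def by (auto intro!: exI[of _ 0])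

lemma null_Un:
  assumes "null A" "null B"
  shows "null (A \<union> B)"
  unfolding null_def
proof (intro allI impI)
  fix e :: real assume e: "e > 0"
  from assms(1) e obtain C where C: "\<And>N. real (card (A \<inter> {..<N})) \<le> e/2 * real N + C"
    unfolding null_def by (meson half_gt_zero)
  from assms(2) e obtain D where D: "\<And>N. real (card (B \<inter> {..<N})) \<le> e/2 * real N + D"
    unfolding null_def by (meson half_gt_zero)
  have "real (card ((A \<union> B) \<inter> {..<N})) \<le> e * real N + (C + D)" for N
  proof -
    have "card ((A \<union> B) \<inter> {..<N}) \<le> card (A \<inter> {..<N}) + card (B \<inter> {..<N})"
      unfolding Int_Un_distrib2 by (rule card_Un_le)
    then have "real (card ((A \<union> B) \<inter> {..<N})) \<le> real (card (A \<inter> {..<N})) + real (card (B \<inter> {..<N}))"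
      by linarith
    then show ?thesis using C[of N] D[of N] by (simp add: field_simps)
  qed
  then show "\<exists>C. \<forall>N. real (card ((A \<union> B) \<inter> {..<N})) \<le> e * real N + C" by blast
qed

lemma null_pointwise2:
  assumes "null {n. P n}" "null {n. Q n}" "\<And>n. R n \<Longrightarrow> P n \<or> Q n"
  shows "null {n. R n}"
  using null_Un[OF assms(1,2)] by (rule null_subset) (use assms(3) in auto)

lemma null_UN:
  assumes "finite I" "\<And>i. i \<in> I \<Longrightarrow> null (A i)"
  shows "null (\<Union>i\<in>I. A i)"
  using assms by (induction I rule: finite_induct) (auto intro: null_Un null_empty)

lemma null_affine:
  assumes "null Z" "q > 0"
  shows "null {n. q * n + r \<in> Z}"
  unfolding null_def
proof (intro allI impI)
  fix e :: real assume e: "e > 0"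
  have "e / real q > 0" using e assms(2) by simp
  with assms(1) obtain C where C: "\<And>N. real (card (Z \<inter> {..<N})) \<le> e / real q * real N + C"
    unfolding null_def by meson
  have "real (card ({n. q * n + r \<in> Z} \<inter> {..<N})) \<le> e * real N + (e / real q * real r + C)" for N
  proof -
    have "card ({n. q * n + r \<in> Z} \<inter> {..<N}) \<le> card (Z \<inter> {..<q * N + r})"
      using assms(2) by (intro card_inj_on_le[where f = "\<lambda>n. q * n + r"]) (auto simp: inj_on_def)
    also have "real \<dots> \<le> e / real q * real (q * N + r) + C" by (rule C)
    also have "\<dots> = e * real N + (e / real q * real r + C)"
      using assms(2) by (simp add: field_simps)
    finally show ?thesis by simp
  qed
  then show "\<exists>C. \<forall>N. real (card ({n. q * n + r \<in> Z} \<inter> {..<N})) \<le> e * real N + C" by blast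
qed

text \<open>The \<open>q\<close> residue classes share the error \<open>e\<close> equally. With
  \<open>null_affine\<close> this reduces density questions to sections modulo
  \<open>q\<close>.\<close>

lemma null_split:
  assumes "q > 0" "\<And>r. r < q \<Longrightarrow> null {n. q * n + r \<in> Z}"
  shows "null Z"
  unfolding null_def
proof (intro allI impI)
  fix e :: real assume e: "e > 0"
  let ?Z = "\<lambda>r. {n. q * n + r \<in> Z}"
  have "\<exists>C. \<forall>N. real (card (?Z r \<inter> {..<N})) \<le> e / real q * real N + C" if "r < q" for r
    using assms(2)[OF that] e assms(1) unfolding null_def by (meson divide_pos_pos of_nat_0_less_iff)
  then obtain C where C: "\<And>r N. r < q \<Longrightarrow> real (card (?Z r \<inter> {..<N})) \<le> e / real q * real N + C r"
    by metis
  have "real (card (Z \<inter> {..<N})) \<le> e * real N + (\<Sum>r<q. C r)" for N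
  proof -
    have "Z \<inter> {..<N} \<subseteq> (\<Union>r\<in>{..<q}. (\<lambda>n. q * n + r) ` (?Z r \<inter> {..<N}))"
    proof
      fix x assume x: "x \<in> Z \<inter> {..<N}"
      have "x div q \<le> x" by simp
      then have "x div q \<in> ?Z (x mod q) \<inter> {..<N}" using x by (auto simp del: div_le_dividend)
      then show "x \<in> (\<Union>r\<in>{..<q}. (\<lambda>n. q * n + r) ` (?Z r \<inter> {..<N}))"
        using assms(1) by (intro UN_I[of "x mod q"] image_eqI[of _ _ "x div q"]) auto
    qed
    then have "card (Z \<inter> {..<N}) \<le> card (\<Union>r\<in>{..<q}. (\<lambda>n. q * n + r) ` (?Z r \<inter> {..<N}))"
      by (intro card_mono) auto
    also have "\<dots> \<le> (\<Sum>r<q. card ((\<lambda>n. q * n + r) ` (?Z r \<inter> {..<N})))"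
      by (intro card_UN_le) auto
    also have "\<dots> \<le> (\<Sum>r<q. card (?Z r \<inter> {..<N}))"
      by (intro sum_mono card_image_le) auto
    finally have "real (card (Z \<inter> {..<N})) \<le> (\<Sum>r<q. real (card (?Z r \<inter> {..<N})))"
      by (metis of_nat_mono of_nat_sum)
    also have "\<dots> \<le> (\<Sum>r<q. e / real q * real N + C r)"
      using C by (intro sum_mono) auto
    also have "\<dots> = e * real N + (\<Sum>r<q. C r)"
      using assms(1) by (simp add: sum.distrib)
    finally show ?thesis .
  qed
  then show "\<exists>C. \<forall>N. real (card (Z \<inter> {..<N})) \<le> e * real N + C" by blast
qed

lemma null_unshift:
  assumes "null {n. Suc n \<in> Z}"
  shows "null Z"
  unfolding null_def
proof (intro allI impI)
  fix e :: real assume e: "e > 0"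
  let ?Y = "{n. Suc n \<in> Z}"
  from assms e obtain C where C: "\<And>N. real (card (?Y \<inter> {..<N})) \<le> e * real N + C"
    unfolding null_def by meson
  have "real (card (Z \<inter> {..<N})) \<le> e * real N + (C + 1)" for N
  proof -
    have "Z \<inter> {..<N} \<subseteq> insert 0 (Suc ` (?Y \<inter> {..<N}))"
    proof
      fix x assume "x \<in> Z \<inter> {..<N}"
      then show "x \<in> insert 0 (Suc ` (?Y \<inter> {..<N}))" by (cases x) auto
    qed
    then have "card (Z \<inter> {..<N}) \<le> card (insert 0 (Suc ` (?Y \<inter> {..<N})))"
      by (intro card_mono) auto
    also have "\<dots> \<le> Suc (card (?Y \<inter> {..<N}))"
      by (metis card_insert_le_m1 card_image diff_Suc_1 inj_Suc inj_on_subset subset_UNIV zero_less_Suc order_refl)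
    finally show ?thesis using C[of N] by simp
  qed
  then show "\<exists>C. \<forall>N. real (card (Z \<inter> {..<N})) \<le> e * real N + C" by blast
qed

lemma null_insert:
  assumes "null Z"
  shows "null (insert x Z)"
proof -
  have "null {x}"
    unfolding null_def
  proof (intro allI impI exI[of _ 1])
    fix e :: real and N assume "e > 0"
    have "card ({x} \<inter> {..<N}) \<le> card {x}" by (intro card_mono) auto
    then show "real (card ({x} \<inter> {..<N})) \<le> e * real N + 1" using \<open>e > 0\<close>
      by (simp add: add_increasing)
  qed
  from null_Un[OF this assms] show ?thesis by simp
qed

text \<open>For sets that would need infinitely many null pieces to cover them: finitely many pieces
  form \<open>T\<close>, and \<open>U\<close> takes the rest, of small upper density.\<close>

lemma null_approx:
  assumes "\<And>e. e > 0 \<Longrightarrow> \<exists>T U C. null T \<and> Z \<subseteq> T \<union> U \<and> (\<forall>N. real (card (U \<inter> {..<N})) \<le> e * real N + C)"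
  shows "null Z"
  unfolding null_def
proof (intro allI impI)
  fix e :: real assume e: "e > 0"
  then obtain T U C where T: "null T" "Z \<subseteq> T \<union> U"
    and U: "\<And>N. real (card (U \<inter> {..<N})) \<le> e / 2 * real N + C"
    using assms[of "e / 2"] by auto
  from T(1) e obtain D where D: "\<And>N. real (card (T \<inter> {..<N})) \<le> e/2 * real N + D"
    unfolding null_def by (meson half_gt_zero)
  have "real (card (Z \<inter> {..<N})) \<le> e * real N + (C + D)" for N
  proof -
    have "card (Z \<inter> {..<N}) \<le> card ((T \<inter> {..<N}) \<union> (U \<inter> {..<N}))"
      using T(2) by (intro card_mono) auto
    also have "\<dots> \<le> card (T \<inter> {..<N}) + card (U \<inter> {..<N})" by (rule card_Un_le)
    finally have "real (card (Z \<inter> {..<N})) \<le> real (card (T \<inter> {..<N})) + real (card (U \<inter> {..<N}))"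
      by linarith
    then show ?thesis using U[of N] D[of N] by (simp add: field_simps)
  qed
  then show "\<exists>C. \<forall>N. real (card (Z \<inter> {..<N})) \<le> e * real N + C" by blast
qed

text \<open>The window contains a fixed proportion of all integers below its end, more than a null
  set can supply once \<open>X\<close> is large.\<close>

lemma null_avoid_interval:
  fixes p w :: real
  assumes "null Z" "p \<ge> 0" "w > 0"
  obtains X0 where "\<And>X. X \<ge> X0 \<Longrightarrow> \<exists>N. N \<notin> Z \<and> p * X \<le> real N \<and> real N < (p + w) * X"
proof -
  \<comment> \<open>With this \<open>e\<close>, up to a constant at most \<open>w * X / 2\<close>
    elements of \<open>Z\<close> lie below \<open>(p + w) * X\<close>, half of what the window would
    contribute.\<close>
  define e where "e = w / (2 * (p + w))"
  have e: "e > 0" using assms by (simp add: e_def)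
  with assms(1) obtain C where C: "\<And>N. real (card (Z \<inter> {..<N})) \<le> e * real N + C"
    unfolding null_def by meson
  define X0 where "X0 = max 1 (2 * (e + C + 2) / w)"
  have "\<exists>N. N \<notin> Z \<and> p * X \<le> real N \<and> real N < (p + w) * X" if X: "X \<ge> X0" for X
  proof (rule ccontr)
    assume neg: "\<not> ?thesis"
    have X1: "X \<ge> 1" using X by (simp add: X0_def)
    define A where "A = nat \<lceil>p * X\<rceil>"
    define B where "B = nat \<lceil>(p + w) * X\<rceil>"
    have pX: "p * X \<ge> 0" and wX: "w * X > 0" using X1 assms by auto
    have A: "p * X \<le> real A" "real A \<le> p * X + 1" unfolding A_def using pX by linarith+
    have B: "(p + w) * X \<le> real B" "real B \<le> (p + w) * X + 1"
      unfolding B_def using pX wX distrib_right[of p w X] by linarith+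
    have "{A..<B} \<subseteq> Z \<inter> {..<B}"
    proof
      fix x assume x: "x \<in> {A..<B}"
      have "p * X \<le> real x" using x A(1) by simp
      moreover have "real x < (p + w) * X"
      proof -
        have "int x < \<lceil>(p + w) * X\<rceil>" using x unfolding B_def by auto
        then show ?thesis by (simp add: less_ceiling_iff)
      qed
      ultimately show "x \<in> Z \<inter> {..<B}" using neg x by auto
    qed
    then have "card {A..<B} \<le> card (Z \<inter> {..<B})" by (intro card_mono) auto
    then have "real B - real A \<le> e * real B + C" using C[of B] by simp
    also have "\<dots> \<le> e * ((p + w) * X + 1) + C" using B(2) e by (simp add: mult_left_mono)
    also have "\<dots> = w * X / 2 + e + C" using assms by (simp add: e_def field_simps)
    finally have "w * X / 2 \<le> e + C + 1" using A(2) B(1) by (simp add: distrib_right)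
    moreover have "2 * (e + C + 2) / w \<le> X" using X by (simp add: X0_def)
    then have "2 * (e + C + 2) \<le> w * X" using assms(3) by (simp add: field_simps)
    ultimately show False by simp
  qed
  then show ?thesis using that by blast
qed

lemma asymp_eq_iff_null: "a \<simeq> b \<longleftrightarrow> null {n. a n \<noteq> b n}"
proof
  have eq: "{n. n < N \<and> a n \<noteq> b n} = {n. a n \<noteq> b n} \<inter> {..<N}" for N by auto
  show "null {n. a n \<noteq> b n}" if "a \<simeq> b"
    unfolding null_def
  proof (intro allI impI)
    fix e :: real assume e: "e > 0"
    from that[unfolded asymp_eq_def] e obtain N0 where
      N0: "\<And>N. N \<ge> N0 \<Longrightarrow> norm (real (card {n. n < N \<and> a n \<noteq> b n}) / real N - 0) < e"
      unfolding LIMSEQ_iff by meson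
    have "real (card ({n. a n \<noteq> b n} \<inter> {..<N})) \<le> e * real N + real N0" for N
    proof (cases "N \<ge> N0 \<and> N > 0")
      case True
      then show ?thesis using N0[of N] by (simp add: eq field_simps)
    next
      case False
      have "card ({n. a n \<noteq> b n} \<inter> {..<N}) \<le> card {..<N}" by (intro card_mono) auto
      then have "card ({n. a n \<noteq> b n} \<inter> {..<N}) \<le> N0" using False by auto
      then show ?thesis using e by (simp add: add_increasing)
    qed
    then show "\<exists>C. \<forall>N. real (card ({n. a n \<noteq> b n} \<inter> {..<N})) \<le> e * real N + C" by blast
  qed
  show "a \<simeq> b" if "null {n. a n \<noteq> b n}"
    unfolding asymp_eq_def LIMSEQ_iff
  proof (intro allI impI)
    fix e :: real assume e: "e > 0"
    with that obtain C where
      C: "\<And>N. real (card ({n. a n \<noteq> b n} \<inter> {..<N})) \<le> e/2 * real N + C"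
      unfolding null_def by (meson half_gt_zero)
    define N0 where "N0 = nat \<lceil>2 * C / e\<rceil> + 1"
    show "\<exists>N0. \<forall>N\<ge>N0. norm (real (card {n. n < N \<and> a n \<noteq> b n}) / real N - 0) < e"
    proof (intro exI allI impI)
      fix N assume N: "N \<ge> N0"
      have "2 * C / e < real N0" unfolding N0_def by linarith
      then have "2 * C / e < real N" using N by linarith
      then have "C < e / 2 * real N" using e by (simp add: field_simps)
      then have "real (card ({n. a n \<noteq> b n} \<inter> {..<N})) < e * real N" using C[of N] by simp
      moreover have "N > 0" using N by (simp add: N0_def)
      ultimately show "norm (real (card {n. n < N \<and> a n \<noteq> b n}) / real N - 0) < e"
        by (simp add: eq field_simps)
    qed
  qed
qed

lemma asymp_eq_affine:
  assumes "a \<simeq> b" "q > 0"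
  shows "(\<lambda>n. a (q * n + r)) \<simeq> (\<lambda>n. b (q * n + r))"
  using null_affine[of "{n. a n \<noteq> b n}" q r] assms by (simp add: asymp_eq_iff_null)

lemma asymp_eq_pointwise2:
  assumes "a \<simeq> b" "c \<simeq> d" "\<And>n. a n = b n \<Longrightarrow> c n = d n \<Longrightarrow> x n = y n"
  shows "x \<simeq> y"
  using null_Un[OF assms(1,2)[unfolded asymp_eq_iff_null]] unfolding asymp_eq_iff_null
  by (rule null_subset) (use assms(3) in auto)

lemma asymp_eq_add: "a \<simeq> b \<Longrightarrow> c \<simeq> d \<Longrightarrow> a + c \<simeq> b + d"
  by (erule (1) asymp_eq_pointwise2) simp

lemma asymp_eq_scale: "a \<simeq> b \<Longrightarrow> seq_scale t a \<simeq> seq_scale t b"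
  by (erule asymp_eq_pointwise2[OF _ asymp_eq_refl]) (simp add: seq_scale_def)

lemma asymp_eq_sum:
  assumes "finite I" "\<And>i. i \<in> I \<Longrightarrow> f i \<simeq> g i"
  shows "(\<lambda>n. \<Sum>i\<in>I. t i * f i n) \<simeq> (\<lambda>n. \<Sum>i\<in>I. t i * g i n)"
  using assms
proof (induction I rule: finite_induct)
  case (insert i I)
  have "f i \<simeq> g i" "(\<lambda>n. \<Sum>i\<in>I. t i * f i n) \<simeq> (\<lambda>n. \<Sum>i\<in>I. t i * g i n)"
    using insert by auto
  then show ?case by (rule asymp_eq_pointwise2) (use insert in simp)
qed (simp add: asymp_eq_refl)

section \<open>Finitely generated modules of sequences\<close>

definition fg :: "(nat \<Rightarrow> int) set \<Rightarrow> bool"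
  where "fg M \<longleftrightarrow> (\<exists>G. finite G \<and> M = int_seq.span G)"

lemma fg_subspace: "fg M \<Longrightarrow> int_seq.subspace M"
  by (auto simp: fg_def)

text \<open>The integers are Noetherian. Elements of \<open>N\<close> that avoid the new generator
  \<open>g\<close> are covered by induction; the coefficients of \<open>g\<close> that occur in
  \<open>N\<close> form an ideal, generated by one of least absolute value.\<close>

lemma fg_submodule_span:
  assumes "finite G" "int_seq.subspace N" "N \<subseteq> int_seq.span G"
  shows "fg N"
  using assms
proof (induction G arbitrary: N rule: finite_induct)
  case empty
  then have "N = {0}" using int_seq.subspace_0 by auto
  then show ?case unfolding fg_def by (intro exI[of _ "{}"]) auto
next
  case (insert g G)
  let ?P = "\<lambda>c. c \<noteq> 0 \<and> (\<exists>x\<in>N. x - seq_scale c g \<in> int_seq.span G)"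
  have "fg (N \<inter> int_seq.span G)"
    using insert by (intro insert.IH int_seq.subspace_inter) auto
  then obtain B where B: "finite B" "N \<inter> int_seq.span G = int_seq.span B"
    unfolding fg_def by blast
  show ?case
  proof (cases "\<exists>c. ?P c")
    case False
    have "N \<subseteq> int_seq.span G"
    proof
      fix x assume x: "x \<in> N"
      then obtain c where "x - seq_scale c g \<in> int_seq.span G"
        using insert.prems(2) by (auto simp: int_seq.span_insert)
      moreover from this have "c = 0" using False x by auto
      ultimately show "x \<in> int_seq.span G" by simp
    qed
    then show ?thesis using B unfolding fg_def by blast
  next
    case True
    then obtain c0 where c0: "?P c0" and min: "\<And>c. ?P c \<Longrightarrow> nat \<bar>c0\<bar> \<le> nat \<bar>c\<bar>"
      using ex_has_least_nat[of ?P _ "\<lambda>c. nat \<bar>c\<bar>"] by blast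
    then obtain y where y: "y \<in> N" "y - seq_scale c0 g \<in> int_seq.span G" by blast
    have "N = int_seq.span (insert y B)"
    proof
      show "int_seq.span (insert y B) \<subseteq> N"
        using y(1) B(2) int_seq.span_superset[of B] insert.prems(1)
        by (intro int_seq.span_minimal) auto
      show "N \<subseteq> int_seq.span (insert y B)"
      proof
        fix x assume x: "x \<in> N"
        then obtain c where c: "x - seq_scale c g \<in> int_seq.span G"
          using insert.prems(2) by (auto simp: int_seq.span_insert)
        \<comment> \<open>Division with remainder leaves \<open>c mod c0\<close> as the coefficient
          of \<open>g\<close> in \<open>?z\<close>; minimality of \<open>c0\<close> forces it to be
          0.\<close>
        let ?z = "x - seq_scale (c div c0) y"
        have zN: "?z \<in> N" using x y(1) insert.prems(1)
          by (intro int_seq.subspace_diff int_seq.subspace_scale)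
        have "?z - seq_scale (c mod c0) g
            = (x - seq_scale c g) - seq_scale (c div c0) (y - seq_scale c0 g)"
        proof
          fix n
          have "c * g n = c div c0 * c0 * g n + c mod c0 * g n"
            by (metis distrib_right div_mult_mod_eq)
          then show "(?z - seq_scale (c mod c0) g) n
            = ((x - seq_scale c g) - seq_scale (c div c0) (y - seq_scale c0 g)) n"
            by (simp add: seq_scale_def algebra_simps)
        qed
        moreover have "\<dots> \<in> int_seq.span G"
          by (rule int_seq.span_diff[OF c int_seq.span_scale[OF y(2)]])
        ultimately have z: "?z - seq_scale (c mod c0) g \<in> int_seq.span G" by (simp only:)
        have "c mod c0 = 0"
        proof (rule ccontr)
          assume "c mod c0 \<noteq> 0"
          then have "nat \<bar>c0\<bar> \<le> nat \<bar>c mod c0\<bar>" using z zN by (intro min) auto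
          then show False using abs_mod_less[of c0 c] c0 by linarith
        qed
        with z zN B(2) have "?z \<in> int_seq.span B" by auto
        then show "x \<in> int_seq.span (insert y B)" by (auto simp: int_seq.span_insert)
      qed
    qed
    then show ?thesis using B(1) unfolding fg_def by blast
  qed
qed

lemma fg_submodule: "fg M \<Longrightarrow> int_seq.subspace N \<Longrightarrow> N \<subseteq> M \<Longrightarrow> fg N"
  using fg_submodule_span unfolding fg_def by blast

text \<open>Zorn's lemma applies because the union of a chain is a submodule of \<open>M\<close>,
  hence finitely generated, and its generators already lie in one member of the chain.\<close>

lemma fg_maximal:
  assumes "fg M" "\<F> \<noteq> {}" "\<And>N. N \<in> \<F> \<Longrightarrow> int_seq.subspace N \<and> N \<subseteq> M"
  obtains N where "N \<in> \<F>" "\<And>N'. N' \<in> \<F> \<Longrightarrow> N \<subseteq> N' \<Longrightarrow> N' = N"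
proof -
  have "\<exists>N\<in>\<F>. \<forall>X\<in>\<F>. N \<subseteq> X \<longrightarrow> X = N"
  proof (rule subset_Zorn_nonempty[OF assms(2)])
    fix \<C> assume ne: "\<C> \<noteq> {}" and ch: "subset.chain \<F> \<C>"
    have sub: "\<And>N. N \<in> \<C> \<Longrightarrow> int_seq.subspace N \<and> N \<subseteq> M \<and> N \<in> \<F>"
      using ch assms(3) unfolding subset_chain_def by auto
    have lin: "A \<subseteq> B \<or> B \<subseteq> A" if "A \<in> \<C>" "B \<in> \<C>" for A B
      using ch that unfolding subset_chain_def by auto
    have "int_seq.subspace (\<Union>\<C>)"
    proof (rule int_seq.subspaceI)
      show "0 \<in> \<Union>\<C>" using ne sub int_seq.subspace_0 by blast
      show "x + y \<in> \<Union>\<C>" if xy: "x \<in> \<Union>\<C>" "y \<in> \<Union>\<C>" for x y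
      proof -
        obtain A B where AB: "A \<in> \<C>" "x \<in> A" "B \<in> \<C>" "y \<in> B" using xy by blast
        with lin[of A B] obtain C where "C \<in> \<C>" "x \<in> C" "y \<in> C" by blast
        then show ?thesis using sub int_seq.subspace_add by blast
      qed
      show "seq_scale c x \<in> \<Union>\<C>" if "x \<in> \<Union>\<C>" for c x
        using that sub int_seq.subspace_scale by blast
    qed
    moreover have "\<Union>\<C> \<subseteq> M" using sub by blast
    ultimately have "fg (\<Union>\<C>)" by (rule fg_submodule[OF assms(1)])
    then obtain G where G: "finite G" "\<Union>\<C> = int_seq.span G" unfolding fg_def by blast
    then have "G \<subseteq> \<Union>\<C>" using int_seq.span_superset by blast
    with G(1) ne ch obtain C where C: "C \<in> \<C>" "G \<subseteq> C"
      using finite_subset_Union_chain[of G \<C> \<F>] by blast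
    then have "int_seq.span G \<subseteq> C" using sub by (intro int_seq.span_minimal) auto
    with G(2) C(1) have "\<Union>\<C> = C" by blast
    then show "\<Union>\<C> \<in> \<F>" using C(1) sub by auto
  qed
  then show ?thesis using that by blast
qed

lemma fg_sum_modules:
  assumes "fg M" "fg N"
  obtains L where "fg L" "M \<subseteq> L" "N \<subseteq> L" "\<And>x. x \<in> L \<Longrightarrow> \<exists>y\<in>M. \<exists>z\<in>N. x = y + z"
proof -
  from assms obtain G B where G: "finite G" "M = int_seq.span G" "finite B" "N = int_seq.span B"
    unfolding fg_def by blast
  show ?thesis
  proof (rule that[of "int_seq.span (G \<union> B)"])
    show "fg (int_seq.span (G \<union> B))" using G unfolding fg_def by blast
    show "M \<subseteq> int_seq.span (G \<union> B)" "N \<subseteq> int_seq.span (G \<union> B)"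
      using G by (auto intro!: int_seq.span_mono)
    show "\<exists>y\<in>M. \<exists>z\<in>N. x = y + z" if "x \<in> int_seq.span (G \<union> B)" for x
      using that G unfolding int_seq.span_Un by blast
  qed
qed

section \<open>Finite determination and integer linear systems\<close>

text \<open>Each new generator costs at most one new point. Identities in a finitely generated
  module can thus be checked at finitely many arguments.\<close>

lemma finite_separating_points:
  assumes "finite G"
  shows "\<exists>E. finite E \<and> E \<subseteq> X \<and>
    (\<forall>f\<in>int_seq.span G. (\<forall>n\<in>E. f n = 0) \<longrightarrow> (\<forall>n\<in>X. f n = 0))"
  using assms
proof (induction G rule: finite_induct)
  case empty
  then show ?case by auto
next
  case (insert g G)
  from insert.IH obtain E where E: "finite E" "E \<subseteq> X"
    and sep: "\<forall>f\<in>int_seq.span G. (\<forall>n\<in>E. f n = 0) \<longrightarrow> (\<forall>n\<in>X. f n = 0)"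
    by (elim exE conjE)
  show ?case
  proof (cases "\<forall>f\<in>int_seq.span (insert g G). (\<forall>n\<in>E. f n = 0) \<longrightarrow> (\<forall>n\<in>X. f n = 0)")
    case True
    then show ?thesis using E by blast
  next
    case False
    then obtain f n0 where f: "f \<in> int_seq.span (insert g G)" "\<forall>n\<in>E. f n = 0"
      "n0 \<in> X" "f n0 \<noteq> 0" by blast
    from f(1) obtain c where c: "f - seq_scale c g \<in> int_seq.span G"
      by (auto simp: int_seq.span_insert)
    have c0: "c \<noteq> 0" using c f bspec[OF sep, of f] by auto
    have "\<forall>n\<in>X. f' n = 0"
      if f': "f' \<in> int_seq.span (insert g G)" "\<forall>n\<in>insert n0 E. f' n = 0" for f'
    proof -
      from f'(1) obtain c' where c': "f' - seq_scale c' g \<in> int_seq.span G"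
        by (auto simp: int_seq.span_insert)
      \<comment> \<open>Cross-multiplication cancels \<open>g\<close>, so the old points already
        decide \<open>?h\<close>; at \<open>n0\<close> only the multiple \<open>c' * f n0\<close>
        survives, which gives \<open>c' = 0\<close>.\<close>
      let ?h = "seq_scale c (f' - seq_scale c' g) - seq_scale c' (f - seq_scale c g)"
      have h: "?h n = c * f' n - c' * f n" for n by (simp add: seq_scale_def algebra_simps)
      have "?h \<in> int_seq.span G" 
        by (rule int_seq.span_diff[OF int_seq.span_scale[OF c'] int_seq.span_scale[OF c]])
      then have z: "\<And>n. n \<in> X \<Longrightarrow> c * f' n - c' * f n = 0"
        using bspec[OF sep, of ?h] f(2) f'(2) unfolding h by simp
      have "c' = 0" using z[OF f(3)] f'(2) f(4) by simp
      then show ?thesis using z c0 by simp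
    qed
    then show ?thesis using E(1,2) f(3) by (intro exI[of _ "insert n0 E"]) blast
  qed
qed

text \<open>Gaussian elimination without fractions, with unknowns indexed by \<open>I\<close> and
  equations by \<open>B\<close>.\<close>

lemma underdetermined_int_system:
  fixes \<alpha> :: "'i \<Rightarrow> 'b \<Rightarrow> int"
  assumes "finite B" "finite I" "card B < card I"
  shows "\<exists>c. (\<exists>i\<in>I. c i \<noteq> 0) \<and> (\<forall>b\<in>B. (\<Sum>i\<in>I. c i * \<alpha> i b) = 0)"
  using assms
proof (induction B arbitrary: I \<alpha> rule: finite_induct)
  case empty
  then obtain i where "i \<in> I" by fastforce
  then show ?case by (intro exI[of _ "\<lambda>_. 1"]) auto
next
  case (insert b B)
  show ?case
  proof (cases "\<forall>i\<in>I. \<alpha> i b = 0")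
    case True
    from insert have "card B < card I" by simp
    from insert.IH[OF insert.prems(1) this, of \<alpha>]
    obtain c where "\<exists>i\<in>I. c i \<noteq> 0" "\<forall>b\<in>B. (\<Sum>i\<in>I. c i * \<alpha> i b) = 0" by blast
    then show ?thesis using True by (intro exI[of _ c]) auto
  next
    case False
    then obtain j where j: "j \<in> I" "\<alpha> j b \<noteq> 0" by blast
    let ?J = "I - {j}"
    have J: "finite ?J" "card B < card ?J" using insert j by auto
    from insert.IH[OF J, of "\<lambda>i x. \<alpha> j b * \<alpha> i x - \<alpha> i b * \<alpha> j x"]
    obtain d where d: "\<exists>i\<in>?J. d i \<noteq> 0"
      "\<And>x. x \<in> B \<Longrightarrow> (\<Sum>i\<in>?J. d i * (\<alpha> j b * \<alpha> i x - \<alpha> i b * \<alpha> j x)) = 0" by blast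
    \<comment> \<open>The unknown at the pivot \<open>j\<close> is chosen to satisfy equation
      \<open>b\<close>; scaling the other unknowns by the pivot \<open>\<alpha> j b\<close> avoids
      division.\<close>
    define c where "c i = (if i = j then - (\<Sum>i\<in>?J. d i * \<alpha> i b) else \<alpha> j b * d i)" for i
    have sm: "(\<Sum>i\<in>I. c i * \<alpha> i x) = (\<Sum>i\<in>?J. d i * (\<alpha> j b * \<alpha> i x - \<alpha> i b * \<alpha> j x))" for x
    proof -
      have "(\<Sum>i\<in>I. c i * \<alpha> i x) = c j * \<alpha> j x + (\<Sum>i\<in>?J. c i * \<alpha> i x)"
        using j insert.prems(1) by (simp add: sum.remove)
      also have "(\<Sum>i\<in>?J. c i * \<alpha> i x) = (\<Sum>i\<in>?J. \<alpha> j b * d i * \<alpha> i x)"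
        by (intro sum.cong) (auto simp: c_def)
      also have "c j * \<alpha> j x = - (\<Sum>i\<in>?J. d i * \<alpha> i b * \<alpha> j x)"
        by (simp add: c_def sum_distrib_right)
      finally show ?thesis by (simp add: algebra_simps sum_subtractf)
    qed
    have "(\<Sum>i\<in>I. c i * \<alpha> i x) = 0" if "x \<in> insert b B" for x
      using that d(2)[of x] unfolding sm by (auto simp: algebra_simps)
    moreover have "\<exists>i\<in>I. c i \<noteq> 0" using d(1) j(2) by (auto simp: c_def)
    ultimately show ?thesis by blast
  qed
qed

section \<open>Modules closed under kernel operations\<close>

definition kclosed :: "nat \<Rightarrow> (nat \<Rightarrow> int) set \<Rightarrow> bool"
  where "kclosed k M \<longleftrightarrow> (\<forall>b\<in>M. \<forall>r<k. (\<lambda>n. b (k * n + r)) \<in> M)"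

definition lclosed :: "nat \<Rightarrow> (nat \<Rightarrow> int) set \<Rightarrow> bool"
  where "lclosed l H \<longleftrightarrow> (\<forall>b\<in>H. \<forall>r<l. \<exists>c\<in>H. (\<lambda>n. b (l * n + r)) \<simeq> c)"

text \<open>Any finitely generated closed module containing \<open>a\<close> will do, since its
  submodules are finitely generated too; this is easier to supply than the kernel module. See
  \<open>k_regular_iff_kreg\<close>.\<close>

definition kreg :: "nat \<Rightarrow> (nat \<Rightarrow> int) \<Rightarrow> bool"
  where "kreg k a \<longleftrightarrow> (\<exists>M. fg M \<and> kclosed k M \<and> a \<in> M)"

text \<open>The generators of the module witnessing asymptotic \<open>l\<close>-regularity are only required to be
  \<open>k\<close>-regular, not to lie in the \<open>l\<close>-kernel module; this makes the notion stable under sums and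
  affine subsequences.\<close>

definition bireg :: "nat \<Rightarrow> nat \<Rightarrow> (nat \<Rightarrow> int) \<Rightarrow> bool"
  where "bireg k l a \<longleftrightarrow> (\<exists>H. fg H \<and> a \<in> H \<and> (\<forall>h\<in>H. kreg k h) \<and> lclosed l H)"

text \<open>Offsets up to and including \<open>R\<close> are kept, so that for
  \<open>q \<le> R\<close> the carries arising from sections modulo \<open>k\<close> or
  \<open>l\<close> stay in range.\<close>

definition affine_subseqs :: "(nat \<Rightarrow> int) set \<Rightarrow> nat \<Rightarrow> nat \<Rightarrow> (nat \<Rightarrow> int) set"
  where "affine_subseqs G q R = (\<Union>s\<le>R. (\<lambda>b n. b (q * n + s)) ` G)"

lemma finite_affine_subseqs: "finite G \<Longrightarrow> finite (affine_subseqs G q R)"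
  by (simp add: affine_subseqs_def)

lemma kclosedD: "kclosed k M \<Longrightarrow> b \<in> M \<Longrightarrow> r < k \<Longrightarrow> (\<lambda>n. b (k * n + r)) \<in> M"
  unfolding kclosed_def by blast

lemma lclosedD: "lclosed l H \<Longrightarrow> b \<in> H \<Longrightarrow> r < l \<Longrightarrow> \<exists>c\<in>H. (\<lambda>n. b (l * n + r)) \<simeq> c"
  unfolding lclosed_def by blast

lemma span_pullback:
  assumes "b \<in> int_seq.span G" "\<And>g. g \<in> G \<Longrightarrow> (\<lambda>n. g (f n)) \<in> int_seq.span S"
  shows "(\<lambda>n. b (f n)) \<in> int_seq.span S"
  using assms(1)
proof (induction b rule: int_seq.span_induct_alt)
  case base
  then show ?case using int_seq.span_zero[of S] by (simp add: zero_fun_def)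
next
  case (step c x y)
  have "seq_scale c (\<lambda>n. x (f n)) + (\<lambda>n. y (f n)) \<in> int_seq.span S"
    by (rule int_seq.span_add[OF int_seq.span_scale[OF assms(2)[OF step.hyps]] step.IH])
  moreover have "(\<lambda>n. (seq_scale c x + y) (f n)) = seq_scale c (\<lambda>n. x (f n)) + (\<lambda>n. y (f n))"
    by (auto simp: seq_scale_def)
  ultimately show ?case by (simp only:)
qed

lemma affine_subseqs_span:
  assumes "b \<in> int_seq.span G" "s \<le> R"
  shows "(\<lambda>n. b (q * n + s)) \<in> int_seq.span (affine_subseqs G q R)"
  by (rule span_pullback[OF assms(1)], rule int_seq.span_base)
    (use assms(2) in \<open>auto simp: affine_subseqs_def\<close>)

lemma kclosed_spanI:
  assumes "\<And>g r. g \<in> G \<Longrightarrow> r < k \<Longrightarrow> (\<lambda>n. g (k * n + r)) \<in> int_seq.span G"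
  shows "kclosed k (int_seq.span G)"
  unfolding kclosed_def
proof (intro ballI allI impI)
  fix b r assume b: "b \<in> int_seq.span G" and r: "r < k"
  from b show "(\<lambda>n. b (k * n + r)) \<in> int_seq.span G"
    by (rule span_pullback) (rule assms[OF _ r])
qed

lemma lclosed_spanI:
  assumes "l > 0"
    "\<And>g r. g \<in> G \<Longrightarrow> r < l \<Longrightarrow> \<exists>c\<in>int_seq.span G. (\<lambda>n. g (l * n + r)) \<simeq> c"
  shows "lclosed l (int_seq.span G)"
  unfolding lclosed_def
proof (intro ballI allI impI)
  fix b r assume b: "b \<in> int_seq.span G" and r: "r < l"
  from b show "\<exists>c\<in>int_seq.span G. (\<lambda>n. b (l * n + r)) \<simeq> c"
  proof (induction b rule: int_seq.span_induct_alt)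
    case base
    show ?case by (rule bexI[OF _ int_seq.span_zero]) (simp add: zero_fun_def asymp_eq_refl)
  next
    case (step c x y)
    obtain u where u: "u \<in> int_seq.span G" "(\<lambda>n. x (l * n + r)) \<simeq> u"
      using assms(2)[OF step.hyps r] by blast
    obtain v where v: "v \<in> int_seq.span G" "(\<lambda>n. y (l * n + r)) \<simeq> v" using step.IH by blast
    have "(\<lambda>n. (seq_scale c x + y) (l * n + r)) \<simeq> seq_scale c u + v"
      using asymp_eq_add[OF asymp_eq_scale[OF u(2)] v(2), of c]
      by (simp add: seq_scale_def plus_fun_def)
    then show ?case using u(1) v(1) by (blast intro: int_seq.span_add int_seq.span_scale)
  qed
qed

lemma kclosed_power:
  assumes "kclosed k M" "b \<in> M" "r < k ^ i"
  shows "(\<lambda>n. b (k ^ i * n + r)) \<in> M"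
  using assms(3)
proof (induction i arbitrary: r)
  case (Suc i)
  let ?b = "\<lambda>n. b (k ^ i * n + r mod k ^ i)"
  have pos: "k ^ i > 0" using Suc.prems by (cases k) auto
  then have "?b \<in> M" by (intro Suc.IH) auto
  moreover have "r div k ^ i < k" using Suc.prems pos by (simp add: less_mult_imp_div_less)
  ultimately have "(\<lambda>n. ?b (k * n + r div k ^ i)) \<in> M"
    by (rule kclosedD[OF assms(1)])
  moreover have "k ^ i * (k * n + r div k ^ i) + r mod k ^ i = k ^ Suc i * n + r" for n
    by (simp add: algebra_simps)
  ultimately show ?case by simp
qed (use assms(2) in simp)

lemma kclosed_affine_subseqs:
  assumes "k > 0" "kclosed k (int_seq.span G)" "q \<le> R"
  shows "kclosed k (int_seq.span (affine_subseqs G q R))"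
proof (rule kclosed_spanI)
  fix g t assume "g \<in> affine_subseqs G q R" and t: "t < k"
  then obtain b s where b: "b \<in> G" "s \<le> R" "g = (\<lambda>n. b (q * n + s))"
    by (auto simp: affine_subseqs_def)
  \<comment> \<open>As \<open>q * (k * n + t) + s = k * (q * n) + ?v\<close>, the remainder
    \<open>?v mod k\<close> selects a section of \<open>b\<close> and the carry
    \<open>?v div k\<close> is its new offset.\<close>
  let ?v = "q * t + s"
  let ?c = "\<lambda>n. b (k * n + ?v mod k)"
  have "?c \<in> int_seq.span G"
    using assms(1) by (intro kclosedD[OF assms(2)] int_seq.span_base[OF b(1)]) simp
  moreover have "?v div k \<le> R"
  proof -
    have "q * t \<le> R * (k - 1)" using assms(3) t by (intro mult_mono) auto
    then have "?v \<le> R * (k - 1) + R" using b(2) by linarith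
    also have "\<dots> = R * k" using assms(1) by (cases k) auto
    finally have "?v div k \<le> R * k div k" by (rule div_le_mono)
    then show ?thesis using assms(1) by simp
  qed
  ultimately have "(\<lambda>n. ?c (q * n + ?v div k)) \<in> int_seq.span (affine_subseqs G q R)"
    by (rule affine_subseqs_span)
  moreover have "k * (q * n + ?v div k) + ?v mod k = q * (k * n + t) + s" for n
    by (simp add: algebra_simps)
  ultimately show "(\<lambda>n. g (k * n + t)) \<in> int_seq.span (affine_subseqs G q R)"
    using b(3) by simp
qed

lemma lclosed_affine_subseqs:
  assumes "l > 0" "lclosed l (int_seq.span G)" "q > 0" "q \<le> R"
  shows "lclosed l (int_seq.span (affine_subseqs G q R))"
proof (rule lclosed_spanI[OF assms(1)])
  fix g t assume "g \<in> affine_subseqs G q R" and t: "t < l"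
  then obtain b s where b: "b \<in> G" "s \<le> R" "g = (\<lambda>n. b (q * n + s))"
    by (auto simp: affine_subseqs_def)
  let ?v = "q * t + s"
  obtain c where c: "c \<in> int_seq.span G" "(\<lambda>n. b (l * n + ?v mod l)) \<simeq> c"
    using assms(1) lclosedD[OF assms(2) int_seq.span_base[OF b(1)], of "?v mod l"] by auto
  have "?v div l \<le> R"
  proof -
    have "q * t \<le> R * (l - 1)" using assms(4) t by (intro mult_mono) auto
    then have "?v \<le> R * (l - 1) + R" using b(2) by linarith
    also have "\<dots> = R * l" using assms(1) by (cases l) auto
    finally have "?v div l \<le> R * l div l" by (rule div_le_mono)
    then show ?thesis using assms(1) by simp
  qed
  with c(1) have "(\<lambda>n. c (q * n + ?v div l)) \<in> int_seq.span (affine_subseqs G q R)"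
    by (rule affine_subseqs_span)
  moreover have "l * (q * n + ?v div l) + ?v mod l = q * (l * n + t) + s" for n
    by (simp add: algebra_simps)
  then have "(\<lambda>n. g (l * n + t)) \<simeq> (\<lambda>n. c (q * n + ?v div l))"
    using asymp_eq_affine[OF c(2) assms(3), of "?v div l"] b(3) by simp
  ultimately show "\<exists>c\<in>int_seq.span (affine_subseqs G q R). (\<lambda>n. g (l * n + t)) \<simeq> c" by blast
qed

section \<open>Stability of regularity under sums, multiples and affine subsequences\<close>

lemma kreg_affine:
  assumes "k > 0" "kreg k a"
  shows "kreg k (\<lambda>n. a (q * n + r))"
proof -
  obtain G where G: "finite G" "kclosed k (int_seq.span G)" "a \<in> int_seq.span G"
    using assms(2) unfolding kreg_def fg_def by blast
  let ?S = "affine_subseqs G q (max q r)"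
  have "kclosed k (int_seq.span ?S)" using assms(1) G(2) by (intro kclosed_affine_subseqs) auto
  moreover have "(\<lambda>n. a (q * n + r)) \<in> int_seq.span ?S" using G(3) by (intro affine_subseqs_span) auto
  ultimately show ?thesis unfolding kreg_def fg_def using finite_affine_subseqs[OF G(1)] by blast
qed

lemma kclosed_sum_modules:
  assumes "fg M" "fg N" "kclosed k M" "kclosed k N"
  obtains L where "fg L" "M \<subseteq> L" "N \<subseteq> L" "kclosed k L"
proof -
  obtain L where L: "fg L" "M \<subseteq> L" "N \<subseteq> L" "\<And>x. x \<in> L \<Longrightarrow> \<exists>y\<in>M. \<exists>z\<in>N. x = y + z"
    using fg_sum_modules[OF assms(1,2)] by blast
  have "kclosed k L"
    unfolding kclosed_def
  proof (intro ballI allI impI)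
    fix b r assume "b \<in> L" "r < k"
    with L(4)[of b] obtain y z where yz: "y \<in> M" "z \<in> N" "b = y + z" by blast
    have "(\<lambda>n. y (k * n + r)) \<in> L" "(\<lambda>n. z (k * n + r)) \<in> L"
      using yz assms(3,4) L(2,3) \<open>r < k\<close> unfolding kclosed_def by blast+
    from int_seq.subspace_add[OF fg_subspace[OF L(1)] this]
    show "(\<lambda>n. b (k * n + r)) \<in> L" unfolding yz(3) by (simp add: plus_fun_def)
  qed
  with L show ?thesis using that by blast
qed

lemma kreg_zero: "kreg k 0"
  unfolding kreg_def fg_def kclosed_def
proof (intro exI conjI)
  show "finite {}" "{0} = int_seq.span {}" by simp_all
  show "\<forall>b\<in>{0}. \<forall>r<k. (\<lambda>n. b (k * n + r)) \<in> {0}" by (simp add: zero_fun_def)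
qed simp

lemma kreg_add:
  assumes "kreg k a" "kreg k b"
  shows "kreg k (a + b)"
proof -
  from assms obtain M N where M: "fg M" "kclosed k M" "a \<in> M" and N: "fg N" "kclosed k N" "b \<in> N"
    unfolding kreg_def by blast
  obtain L where L: "fg L" "M \<subseteq> L" "N \<subseteq> L" "kclosed k L"
    using kclosed_sum_modules[OF M(1) N(1) M(2) N(2)] by blast
  then have "a + b \<in> L" using M(3) N(3) int_seq.subspace_add[OF fg_subspace[OF L(1)]] by blast
  then show ?thesis using L unfolding kreg_def by blast
qed

lemma kreg_scale:
  assumes "kreg k a"
  shows "kreg k (seq_scale c a)"
proof -
  from assms obtain M where M: "fg M" "kclosed k M" "a \<in> M" unfolding kreg_def by (elim exE conjE)
  moreover have "seq_scale c a \<in> M" by (rule int_seq.subspace_scale[OF fg_subspace[OF M(1)] M(3)])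
  ultimately show ?thesis unfolding kreg_def by (intro exI[of _ M] conjI)
qed

lemma subspace_kreg: "int_seq.subspace {a. kreg k a}"
  by (rule int_seq.subspaceI) (auto intro: kreg_zero kreg_add kreg_scale)

lemma kreg_span:
  assumes "a \<in> int_seq.span G" "\<And>g. g \<in> G \<Longrightarrow> kreg k g"
  shows "kreg k a"
proof -
  have "int_seq.span G \<subseteq> {a. kreg k a}"
    using assms(2) by (intro int_seq.span_minimal[OF _ subspace_kreg]) auto
  then show ?thesis using assms(1) by auto
qed

lemma kreg_common_module:
  assumes "fg H" "\<And>h. h \<in> H \<Longrightarrow> kreg k h"
  obtains M where "fg M" "kclosed k M" "H \<subseteq> M"
proof -
  have "\<exists>M. fg M \<and> kclosed k M \<and> G \<subseteq> M" if "finite G" "\<And>h. h \<in> G \<Longrightarrow> kreg k h" for G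
    using that
  proof (induction G rule: finite_induct)
    case empty
    then show ?case using kreg_zero[of k] unfolding kreg_def by blast
  next
    case (insert g G)
    then obtain M N where M: "fg M" "kclosed k M" "G \<subseteq> M" and N: "fg N" "kclosed k N" "g \<in> N"
      unfolding kreg_def by blast
    obtain L where "fg L" "M \<subseteq> L" "N \<subseteq> L" "kclosed k L"
      using kclosed_sum_modules[OF M(1) N(1) M(2) N(2)] by blast
    then show ?case using M(3) N(3) by (intro exI[of _ L]) auto
  qed
  moreover obtain G where G: "finite G" "H = int_seq.span G" using assms(1) unfolding fg_def by blast
  moreover have "\<And>h. h \<in> G \<Longrightarrow> kreg k h" using assms(2) G int_seq.span_base by blast
  ultimately obtain M where M: "fg M" "kclosed k M" "G \<subseteq> M" by metis
  have "H \<subseteq> M" unfolding G(2) by (rule int_seq.span_minimal[OF M(3) fg_subspace[OF M(1)]])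
  with M show ?thesis using that by blast
qed

lemma bireg_affine:
  assumes "k > 0" "l > 0" "q > 0" "bireg k l a"
  shows "bireg k l (\<lambda>n. a (q * n + r))"
proof -
  obtain G where G: "finite G" "a \<in> int_seq.span G" "\<And>h. h \<in> int_seq.span G \<Longrightarrow> kreg k h"
    "lclosed l (int_seq.span G)"
    using assms(4) unfolding bireg_def fg_def by blast
  let ?S = "affine_subseqs G q (max q r)"
  have "lclosed l (int_seq.span ?S)" using assms G(4) by (intro lclosed_affine_subseqs) auto
  moreover have "(\<lambda>n. a (q * n + r)) \<in> int_seq.span ?S" using G(2) by (intro affine_subseqs_span) auto
  moreover have "kreg k g" if "g \<in> G" for g
    using that by (intro G(3) int_seq.span_base)
  then have "kreg k h" if "h \<in> int_seq.span ?S" for h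
    using that by (elim kreg_span) (auto simp: affine_subseqs_def intro!: kreg_affine assms)
  moreover have "fg (int_seq.span ?S)" unfolding fg_def using finite_affine_subseqs[OF G(1)] by blast
  ultimately show ?thesis unfolding bireg_def by blast
qed

lemma bireg_add:
  assumes "bireg k l a" "bireg k l b"
  shows "bireg k l (a + b)"
proof -
  from assms obtain H K where H: "fg H" "a \<in> H" "\<And>h. h \<in> H \<Longrightarrow> kreg k h" "lclosed l H"
    and K: "fg K" "b \<in> K" "\<And>h. h \<in> K \<Longrightarrow> kreg k h" "lclosed l K"
    unfolding bireg_def by blast
  obtain L where L: "fg L" "H \<subseteq> L" "K \<subseteq> L" "\<And>x. x \<in> L \<Longrightarrow> \<exists>y\<in>H. \<exists>z\<in>K. x = y + z"
    using fg_sum_modules[OF H(1) K(1)] by blast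
  have "a + b \<in> L" using L(2,3) H(2) K(2) int_seq.subspace_add[OF fg_subspace[OF L(1)]] by blast
  moreover have "kreg k h" if "h \<in> L" for h
    using L(4)[OF that] H(3) K(3) kreg_add by blast
  moreover have "lclosed l L"
    unfolding lclosed_def
  proof (intro ballI allI impI)
    fix x r assume "x \<in> L" "r < l"
    with L(4)[of x] obtain y z where yz: "y \<in> H" "z \<in> K" "x = y + z" by blast
    from yz(1) H(4) \<open>r < l\<close> obtain u where u: "u \<in> H" "(\<lambda>n. y (l * n + r)) \<simeq> u"
      unfolding lclosed_def by blast
    from yz(2) K(4) \<open>r < l\<close> obtain v where v: "v \<in> K" "(\<lambda>n. z (l * n + r)) \<simeq> v"
      unfolding lclosed_def by blast
    have "u + v \<in> L" using L(2,3) u(1) v(1) int_seq.subspace_add[OF fg_subspace[OF L(1)]] by blast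
    moreover have "(\<lambda>n. x (l * n + r)) \<simeq> u + v"
      using asymp_eq_add[OF u(2) v(2)] unfolding yz(3) by (simp add: plus_fun_def)
    ultimately show "\<exists>c\<in>L. (\<lambda>n. x (l * n + r)) \<simeq> c" by blast
  qed
  ultimately show ?thesis using L(1) unfolding bireg_def by blast
qed

lemma bireg_scale:
  assumes "bireg k l a"
  shows "bireg k l (seq_scale c a)"
proof -
  from assms obtain H where H: "fg H" "a \<in> H" "\<forall>h\<in>H. kreg k h" "lclosed l H"
    unfolding bireg_def by (elim exE conjE)
  moreover have "seq_scale c a \<in> H" by (rule int_seq.subspace_scale[OF fg_subspace[OF H(1)] H(2)])
  ultimately show ?thesis unfolding bireg_def by (intro exI[of _ H] conjI)
qed

section \<open>Kernel modules in terms of closed modules\<close>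

lemma k_kernel_nested:
  assumes "b \<in> k_kernel k a" "r < k"
  shows "(\<lambda>n. b (k * n + r)) \<in> k_kernel k a"
proof -
  from assms(1) obtain i s where b: "b = (\<lambda>n. a (k ^ i * n + s))" "s < k ^ i"
    unfolding k_kernel_def by blast
  have "k ^ i * r + s < k ^ i * (r + 1)" using b(2) by simp
  also have "\<dots> \<le> k ^ i * k" using assms(2) by (intro mult_left_mono) auto
  finally have "k ^ i * r + s < k ^ Suc i" by (simp add: mult.commute)
  moreover have "(\<lambda>n. b (k * n + r)) = (\<lambda>n. a (k ^ Suc i * n + (k ^ i * r + s)))"
    by (simp add: b(1) algebra_simps)
  ultimately show ?thesis unfolding k_kernel_def by blast
qed

lemma kclosed_k_kernel_module: "kclosed k (k_kernel_module k a)"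
  unfolding k_kernel_module_def
  by (rule kclosed_spanI, rule int_seq.span_base, rule k_kernel_nested)

lemma self_in_k_kernel: "a \<in> k_kernel k a"
  unfolding k_kernel_def by (auto intro!: exI[of _ 0])

lemma k_kernel_subset_kclosed:
  assumes "kclosed k M" "a \<in> M"
  shows "k_kernel k a \<subseteq> M"
  by (auto simp: k_kernel_def intro: kclosed_power[OF assms])

text \<open>The kernel module is itself closed; conversely it lies inside every closed module
  containing \<open>a\<close> and inherits finite generation.\<close>

lemma k_regular_iff_kreg: "k_regular k a \<longleftrightarrow> kreg k a"
proof
  show "kreg k a" if "k_regular k a"
    using that kclosed_k_kernel_module[of k a] self_in_k_kernel[of a k] int_seq.span_base
    unfolding k_regular_def kreg_def fg_def k_kernel_module_def by metis
  show "k_regular k a" if "kreg k a"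
  proof -
    obtain M where M: "fg M" "kclosed k M" "a \<in> M" using \<open>kreg k a\<close> unfolding kreg_def by blast
    have "k_kernel_module k a \<subseteq> M"
      unfolding k_kernel_module_def
      by (rule int_seq.span_minimal[OF k_kernel_subset_kclosed[OF M(2,3)] fg_subspace[OF M(1)]])
    then have "fg (k_kernel_module k a)"
      by (intro fg_submodule[OF M(1)]) (auto simp: k_kernel_module_def)
    then show ?thesis unfolding k_regular_def fg_def by metis
  qed
qed

text \<open>Elements of the \<open>l\<close>-kernel module are combinations of affine subsequences
  of \<open>a\<close>, hence \<open>k\<close>-regular. Adjoining \<open>a\<close> to the
  representatives \<open>G\<close> keeps \<open>lclosed\<close>, since \<open>G\<close> already
  represents every section.\<close>

lemma bireg_if_regular:
  assumes "k > 0" "l > 0" "k_regular k a" "asymp_k_regular l a"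
  shows "bireg k l a"
proof -
  from assms(4) obtain G where G: "finite G" "G \<subseteq> k_kernel_module l a"
    "\<And>b. b \<in> k_kernel_module l a \<Longrightarrow> \<exists>c\<in>int_seq.span G. b \<simeq> c"
    unfolding asymp_k_regular_iff by blast
  have aM: "a \<in> k_kernel_module l a"
    unfolding k_kernel_module_def by (rule int_seq.span_base[OF self_in_k_kernel])
  let ?H = "int_seq.span (insert a G)"
  have HM: "?H \<subseteq> k_kernel_module l a"
    using G(2) aM unfolding k_kernel_module_def by (intro int_seq.span_minimal) auto
  have "kreg k a" using assms(3) by (simp add: k_regular_iff_kreg)
  then have "kreg k h" if "h \<in> k_kernel_module l a" for h
    using that unfolding k_kernel_module_def
    by (elim kreg_span) (auto simp: k_kernel_def intro: kreg_affine[OF assms(1)])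
  moreover have "lclosed l ?H"
    unfolding lclosed_def
  proof (intro ballI allI impI)
    fix b r assume "b \<in> ?H" "r < l"
    then have "(\<lambda>n. b (l * n + r)) \<in> k_kernel_module l a"
      using HM kclosed_k_kernel_module[of l a] unfolding kclosed_def by blast
    from G(3)[OF this] show "\<exists>c\<in>?H. (\<lambda>n. b (l * n + r)) \<simeq> c"
      using int_seq.span_mono[of G "insert a G"] by blast
  qed
  ultimately show ?thesis
    using HM G(1) unfolding bireg_def fg_def
    by (intro exI[of _ ?H]) (auto intro: int_seq.span_base)
qed

section \<open>Slowly varying sequences are asymptotically constant\<close>

text \<open>Dirichlet's pigeonhole argument for the multiples of
  \<open>\<theta> = ln k / ln l\<close>, followed by exponentiation. Coprimality excludes the ratio
  1.\<close>

lemma near_one_power_ratio: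
  fixes k l :: nat and \<delta> :: real
  assumes "k \<ge> 2" "l \<ge> 2" "coprime k l" "\<delta> > 0"
  obtains i j :: nat where "real k ^ i / real l ^ j \<noteq> 1" "\<bar>real k ^ i / real l ^ j - 1\<bar> < \<delta>"
proof -
  have "isCont exp (0::real)" by simp
  then obtain \<eta> where \<eta>: "\<eta> > 0" "\<And>x::real. \<bar>x\<bar> < \<eta> \<Longrightarrow> \<bar>exp x - 1\<bar> < \<delta>"
    unfolding isCont_def LIM_eq using assms(4) by (metis abs_0 diff_0_right diff_self exp_zero real_norm_def)
  define \<theta> where "\<theta> = ln (real k) / ln (real l)"
  have lnl: "ln (real l) > 0" using assms(2) by simp
  have \<theta>0: "\<theta> > 0" using assms(1) lnl by (simp add: \<theta>_def)
  obtain K :: nat where K: "real K > ln (real l) / \<eta>" using reals_Archimedean2 by blast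
  have "ln (real l) / \<eta> > 0" using lnl \<eta>(1) by simp
  then have K0: "real K > 0" using K by linarith
  \<comment> \<open>\<open>f i\<close> numbers the bin of width \<open>1 / K\<close> that contains
    the fractional part of \<open>i * \<theta>\<close>; two indices in one bin differ by some
    \<open>d\<close> with \<open>d * \<theta>\<close> within \<open>1 / K\<close> of an
    integer.\<close>
  define f where "f i = \<lfloor>real K * frac (real i * \<theta>)\<rfloor>" for i :: nat
  have "range f \<subseteq> {0..int K}"
  proof clarify
    fix i
    have "real K * frac (real i * \<theta>) < real K * 1" using K0 frac_lt_1 by (intro mult_strict_left_mono)
    moreover have "0 \<le> real K * frac (real i * \<theta>)" by simp
    ultimately show "f i \<in> {0..int K}" unfolding f_def by (simp add: floor_le_iff)
  qed
  then have "finite (range f)" by (rule finite_subset) simp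
  then have "\<not> inj f" using finite_imageD infinite_UNIV_nat by blast
  then obtain i i' where "f i = f i'" "i < i'" unfolding inj_def by (metis linorder_neqE_nat)
  then have "\<bar>real K * frac (real i' * \<theta>) - real K * frac (real i * \<theta>)\<bar> < 1"
    unfolding f_def by linarith
  then have "real K * \<bar>frac (real i' * \<theta>) - frac (real i * \<theta>)\<bar> < 1"
    using K0 by (simp add: abs_mult flip: right_diff_distrib)
  then have fr: "\<bar>frac (real i' * \<theta>) - frac (real i * \<theta>)\<bar> < 1 / real K"
    using K0 by (simp add: field_simps)
  define j where "j = nat (\<lfloor>real i' * \<theta>\<rfloor> - \<lfloor>real i * \<theta>\<rfloor>)"
  have "real i * \<theta> \<le> real i' * \<theta>" using \<theta>0 \<open>i < i'\<close> by simp
  then have "\<lfloor>real i * \<theta>\<rfloor> \<le> \<lfloor>real i' * \<theta>\<rfloor>" by (rule floor_mono)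
  then have j: "real j = real_of_int \<lfloor>real i' * \<theta>\<rfloor> - real_of_int \<lfloor>real i * \<theta>\<rfloor>" unfolding j_def by simp
  have "\<bar>real (i' - i) * \<theta> - real j\<bar> < 1 / real K"
    using fr \<open>i < i'\<close> unfolding j frac_def by (simp add: of_nat_diff left_diff_distrib algebra_simps)
  then have "\<bar>real (i' - i) * \<theta> - real j\<bar> * ln (real l) < 1 / real K * ln (real l)"
    using lnl by (rule mult_strict_right_mono)
  moreover have "(real (i' - i) * \<theta> - real j) * ln (real l) = real (i' - i) * ln (real k) - real j * ln (real l)"
    using lnl by (simp add: \<theta>_def left_diff_distrib)
  then have "\<bar>real (i' - i) * \<theta> - real j\<bar> * ln (real l) = \<bar>real (i' - i) * ln (real k) - real j * ln (real l)\<bar>"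
    using lnl by (metis abs_mult abs_of_pos)
  moreover have "1 / real K * ln (real l) < \<eta>" using K K0 \<eta>(1) by (simp add: field_simps)
  ultimately have "\<bar>real (i' - i) * ln (real k) - real j * ln (real l)\<bar> < \<eta>" by linarith
  from \<eta>(2)[OF this] have "\<bar>real k ^ (i' - i) / real l ^ j - 1\<bar> < \<delta>"
    using assms(1,2) by (simp add: exp_diff exp_of_nat_mult)
  moreover have "real k ^ (i' - i) / real l ^ j \<noteq> 1"
  proof
    assume "real k ^ (i' - i) / real l ^ j = 1"
    then have "real (k ^ (i' - i)) = real (l ^ j)" using assms(2) by (simp add: field_simps)
    then have "k ^ (i' - i) = l ^ j" by (simp only: of_nat_eq_iff)
    moreover have "coprime (k ^ (i' - i)) (l ^ j)" using assms(3) by simp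
    ultimately have "k ^ (i' - i) = 1" by simp
    then show False using assms(1) \<open>i < i'\<close> by simp
  qed
  ultimately show ?thesis using that by blast
qed

lemma null_avoid_block:
  fixes p w :: real
  assumes "null Z" "p \<ge> 0" "w > 0" "k \<ge> (2::nat)"
  shows "\<forall>\<^sub>F s in sequentially. \<exists>N. N \<notin> Z \<and> p * real k ^ s \<le> real N \<and> real N < (p + w) * real k ^ s"
proof -
  obtain X0 where X0: "\<And>X. X \<ge> X0 \<Longrightarrow> \<exists>N. N \<notin> Z \<and> p * X \<le> real N \<and> real N < (p + w) * X"
    using null_avoid_interval[OF assms(1-3)] by blast
  have "filterlim (\<lambda>s. real k ^ s) at_top sequentially"
    using assms(4) by (intro filterlim_at_infinity_imp_filterlim_at_top filterlim_realpow_sequentially_gt1) auto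
  then have "\<forall>\<^sub>F s in sequentially. X0 \<le> real k ^ s" by (simp add: filterlim_at_top)
  then show ?thesis by eventually_elim (rule X0)
qed

lemma asymp_shift:
  assumes "(\<lambda>n. b (Suc n)) \<simeq> b"
  shows "(\<lambda>n. b (n + s)) \<simeq> b"
proof (induction s)
  case (Suc s)
  have "(\<lambda>n. b (n + Suc s)) \<simeq> (\<lambda>n. b (n + s))"
    using asymp_eq_affine[OF assms, of 1 s] by simp
  then show ?case using Suc by (rule asymp_eq_trans)
qed (simp add: asymp_eq_refl)

lemma asymp_shift_affine:
  assumes "(\<lambda>n. b (Suc n)) \<simeq> b" "q > 0"
  shows "(\<lambda>n. b (q * n + r)) \<simeq> (\<lambda>n. b (q * n))"
  using asymp_eq_affine[OF asymp_shift[OF assms(1), of r] assms(2), of 0] by simp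

lemma asymp_shift_of_affine:
  assumes "(\<lambda>n. b (Suc n)) \<simeq> b" "q > 0"
  shows "(\<lambda>n. b (q * Suc n + r)) \<simeq> (\<lambda>n. b (q * n + r))"
  using asymp_eq_affine[OF asymp_shift[OF assms(1), of q] assms(2), of r] by (simp add: algebra_simps)

lemma span_vanish:
  assumes "b \<in> int_seq.span G" "\<And>g. g \<in> G \<Longrightarrow> g n = 0"
  shows "b n = 0"
  using assms(1) by (induction b rule: int_seq.span_induct_alt) (auto simp: seq_scale_def assms(2))

text \<open>One exceptional set serves the whole module: the union of those of finitely many
  generators.\<close>

lemma null_common_zeros:
  assumes "fg N" "\<And>b. b \<in> N \<Longrightarrow> b \<simeq> 0"
  shows "null {n. \<exists>b\<in>N. b n \<noteq> 0}"
proof -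
  obtain G where G: "finite G" "N = int_seq.span G" using assms(1) unfolding fg_def by blast
  have "null (\<Union>g\<in>G. {n. g n \<noteq> 0})"
  proof (rule null_UN[OF G(1)])
    fix g assume "g \<in> G"
    then have "g \<simeq> 0" using G(2) assms(2) int_seq.span_base by blast
    then show "null {n. g n \<noteq> 0}" by (simp add: asymp_eq_iff_null)
  qed
  then show ?thesis by (rule null_subset) (use span_vanish G(2) in blast)
qed

lemma lclosed_power:
  assumes "lclosed l H" "l > 0" "b \<in> H" "r < l ^ i"
  shows "\<exists>c\<in>H. (\<lambda>n. b (l ^ i * n + r)) \<simeq> c"
  using assms(4)
proof (induction i arbitrary: r)
  case 0
  then show ?case using assms(3) by (auto intro: asymp_eq_refl)
next
  case (Suc i)
  have pos: "l ^ i > 0" using assms(2) by simp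
  then obtain c where c: "c \<in> H" "(\<lambda>n. b (l ^ i * n + r mod l ^ i)) \<simeq> c"
    using Suc.IH[of "r mod l ^ i"] by auto
  have "r div l ^ i < l" using Suc.prems pos by (simp add: less_mult_imp_div_less)
  from lclosedD[OF assms(1) c(1) this]
  obtain d where d: "d \<in> H" "(\<lambda>n. c (l * n + r div l ^ i)) \<simeq> d" by blast
  have "l ^ i * (l * n + r div l ^ i) + r mod l ^ i = l ^ Suc i * n + r" for n
    by (simp add: algebra_simps)
  with asymp_eq_affine[OF c(2) assms(2), of "r div l ^ i"]
  have "(\<lambda>n. b (l ^ Suc i * n + r)) \<simeq> (\<lambda>n. c (l * n + r div l ^ i))" by simp
  from asymp_eq_trans[OF this d(2)] d(1) show ?case by blast
qed

text \<open>The intervals \<open>[f, f + 1)\<close> and \<open>u ^ t * [g, g + 1)\<close> are made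
  to overlap. Powers of \<open>u\<close> push the second towards the first, and near
  \<open>f\<close> one step moves by less than 1, so the first \<open>t\<close> that does not fall
  short cannot overshoot.\<close>

lemma power_ratio_overlap:
  fixes u :: real and f g :: nat
  assumes "u > 0" "u \<noteq> 1" "\<bar>u - 1\<bar> * (real f + 1) < 1" "(u > 1 \<and> g \<le> f) \<or> (u < 1 \<and> f \<le> g)" "g > 0"
  obtains t where "u ^ t * real g < real f + 1" "real f < u ^ t * (real g + 1)"
proof (cases "u > 1")
  case True
  then have g: "g \<le> f" using assms(4) by auto
  let ?P = "\<lambda>t. real f < u ^ t * (real g + 1)"
  obtain t0 where "real f < u ^ t0" using real_arch_pow[OF True] by blast
  also have "u ^ t0 \<le> u ^ t0 * (real g + 1)" using assms(1) by simp
  finally have P: "?P (LEAST t. ?P t)" by (rule LeastI)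
  define t where "t = (LEAST t. ?P t)"
  have "u ^ t * real g < real f + 1"
  proof (cases t)
    case 0
    then show ?thesis using g by simp
  next
    case (Suc t')
    then have "\<not> ?P t'" using not_less_Least[of t' ?P] by (simp add: t_def)
    then have "u ^ t' * (real g + 1) \<le> real f" by simp
    moreover have "u ^ t' * real g \<le> u ^ t' * (real g + 1)" using assms(1) by simp
    ultimately have "u ^ t' * real g \<le> real f" by linarith
    then have "u * (u ^ t' * real g) \<le> u * real f" using assms(1) by simp
    moreover have "(u - 1) * real f \<le> (u - 1) * (real f + 1)" using True by simp
    moreover have "(u - 1) * (real f + 1) < 1" using assms(3) True by simp
    moreover have "u * real f = real f + (u - 1) * real f" by (simp add: algebra_simps)
    ultimately have "u * (u ^ t' * real g) < real f + 1" by linarith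
    then show ?thesis using Suc by (simp add: mult.assoc)
  qed
  then show ?thesis using P that unfolding t_def by blast
next
  case False
  then have u: "u < 1" and f: "f \<le> g" using assms(2,4) by auto
  let ?P = "\<lambda>t. u ^ t * real g < real f + 1"
  obtain t0 where "u ^ t0 < (real f + 1) / real g"
    using real_arch_pow_inv[of "(real f + 1) / real g" u] u assms(5) by auto
  then have "?P t0" using assms(5) by (simp add: field_simps)
  then have P: "?P (LEAST t. ?P t)" by (rule LeastI)
  define t where "t = (LEAST t. ?P t)"
  have "real f < u ^ t * (real g + 1)"
  proof (cases t)
    case 0
    then show ?thesis using f by simp
  next
    case (Suc t')
    then have "\<not> ?P t'" using not_less_Least[of t' ?P] by (simp add: t_def)
    then have "real f + 1 \<le> u ^ t' * real g" by simp
    moreover have "u ^ t' * real g \<le> u ^ t' * (real g + 1)" using assms(1) by simp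
    ultimately have "real f + 1 \<le> u ^ t' * (real g + 1)" by linarith
    then have "u * (real f + 1) \<le> u * (u ^ t' * (real g + 1))" using assms(1) by simp
    moreover have "(1 - u) * (real f + 1) < 1" using assms(3) u by simp
    moreover have "u * (real f + 1) = real f + 1 - (1 - u) * (real f + 1)" by (simp add: algebra_simps)
    ultimately have "real f < u * (u ^ t' * (real g + 1))" by linarith
    then show ?thesis using Suc by (simp add: mult.assoc)
  qed
  then show ?thesis using P that unfolding t_def by blast
qed

text \<open>Everything happens in one finitely generated \<open>k\<close>-closed module
  \<open>M\<close> of slowly varying sequences. There the block values at finitely many indices
  decide whether a sequence is asymptotically zero, and powers of \<open>k ^ i / l ^ j\<close>
  compare these indices with each other.\<close>

lemma asymp_constant:
  assumes k: "k \<ge> 2" and l: "l \<ge> 2" and cop: "coprime k l"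
    and bi: "bireg k l a" and lc: "(\<lambda>n. a (Suc n)) \<simeq> a"
  shows "\<exists>c. a \<simeq> (\<lambda>_. c)"
proof -
  obtain H where H: "fg H" "a \<in> H" "\<And>h. h \<in> H \<Longrightarrow> kreg k h" "lclosed l H"
    using bi unfolding bireg_def by blast
  obtain M0 where M0: "fg M0" "kclosed k M0" "H \<subseteq> M0" using kreg_common_module[OF H(1,3)] by blast
  \<comment> \<open>Constants are adjoined because \<open>a\<close> is finally compared with a
    constant inside \<open>M\<close>.\<close>
  have "kclosed k (int_seq.span {\<lambda>_. 1})" by (rule kclosed_spanI) (auto intro: int_seq.span_base)
  moreover have "fg (int_seq.span {\<lambda>_. 1})" unfolding fg_def by blast
  ultimately obtain L where L: "fg L" "M0 \<subseteq> L" "int_seq.span {\<lambda>_. 1} \<subseteq> L" "kclosed k L"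
    using kclosed_sum_modules[OF M0(1) _ M0(2)] by blast
  define LC where "LC = {b :: nat \<Rightarrow> int. (\<lambda>n. b (Suc n)) \<simeq> b}"
  have sLC: "int_seq.subspace LC"
  proof (rule int_seq.subspaceI)
    show "0 \<in> LC" by (simp add: LC_def zero_fun_def asymp_eq_refl)
    show "x + y \<in> LC" if "x \<in> LC" "y \<in> LC" for x y
      using asymp_eq_add[of "\<lambda>n. x (Suc n)" x "\<lambda>n. y (Suc n)" y] that
      by (simp add: LC_def plus_fun_def)
    show "seq_scale c x \<in> LC" if "x \<in> LC" for c x
      using asymp_eq_scale[of "\<lambda>n. x (Suc n)" x c] that by (simp add: LC_def seq_scale_def)
  qed
  define M where "M = L \<inter> LC"
  have sM: "int_seq.subspace M"
    unfolding M_def by (rule int_seq.subspace_inter[OF fg_subspace[OF L(1)] sLC])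
  have fM: "fg M" by (rule fg_submodule[OF L(1) sM]) (simp add: M_def)
  have kM: "kclosed k M"
    unfolding kclosed_def
  proof (intro ballI allI impI)
    fix b r assume "b \<in> M" "r < k"
    then show "(\<lambda>n. b (k * n + r)) \<in> M"
      using kclosedD[OF L(4), of b r] asymp_shift_of_affine[of b k r] k by (simp add: M_def LC_def)
  qed
  have MLC: "(\<lambda>n. b (Suc n)) \<simeq> b" if "b \<in> M" for b using that by (simp add: M_def LC_def)
  have aM: "a \<in> M" using H(2) M0(3) L(2) lc by (auto simp: M_def LC_def)
  have constM: "(\<lambda>_. c) \<in> M" for c
  proof -
    have "seq_scale c (\<lambda>_. 1) \<in> L" using L(3) int_seq.span_base int_seq.span_scale by blast
    then show ?thesis by (simp add: M_def LC_def seq_scale_def asymp_eq_refl)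
  qed
  define N0 where "N0 = M \<inter> {b. b \<simeq> 0}"
  have "int_seq.subspace {b. b \<simeq> 0}"
    by (rule int_seq.subspaceI)
      (use asymp_eq_add[of _ 0 _ 0] asymp_eq_scale[of _ 0] in \<open>auto simp: asymp_eq_refl\<close>)
  then have sN: "int_seq.subspace N0" unfolding N0_def by (rule int_seq.subspace_inter[OF sM])
  have "fg N0" by (rule fg_submodule[OF fM sN]) (simp add: N0_def)
  then have nz: "null {n. \<exists>b\<in>N0. b n \<noteq> 0}" by (rule null_common_zeros) (simp add: N0_def)
  \<comment> \<open>Indices at which every asymptotically zero element of \<open>M\<close> is
    exactly zero. The index 0 is left out because \<open>power_ratio_overlap\<close> asks for a
    positive one.\<close>
  define X where "X = {n. n > 0 \<and> (\<forall>b\<in>N0. b n = 0)}"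
  have nX: "null (- X)"
    by (rule null_subset[OF null_insert[OF nz, of 0]]) (auto simp: X_def)
  \<comment> \<open>The difference of two sections of \<open>b\<close> modulo \<open>k ^ i\<close>
    lies in \<open>M\<close> and is asymptotically zero, hence vanishes at every point of
    \<open>X\<close>: \<open>b\<close> is constant on the block of \<open>n\<close>.\<close>
  have block0: "b (k ^ i * n + r) = b (k ^ i * n)" if "n \<in> X" "b \<in> M" "r < k ^ i" for b n r i
  proof -
    let ?d = "(\<lambda>n. b (k ^ i * n + r)) - (\<lambda>n. b (k ^ i * n + 0))"
    have "?d \<in> M" by (rule int_seq.subspace_diff[OF sM]) (rule kclosed_power[OF kM that(2)], use that(3) k in simp)+
    moreover have "?d \<simeq> 0"
      using asymp_shift_affine[OF MLC[OF that(2)], of "k ^ i" r] k by (simp add: asymp_eq_iff_null)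
    ultimately have "?d \<in> N0" by (simp add: N0_def)
    moreover have "\<forall>b\<in>N0. b n = 0" using that(1) by (simp add: X_def)
    ultimately have "?d n = 0" by blast
    then show ?thesis by simp
  qed
  have block: "b N = b (k ^ i * n)" if "n \<in> X" "b \<in> M" "k ^ i * n \<le> N" "N < k ^ i * (n + 1)" for b n N i
    using block0[OF that(1,2), of "N - k ^ i * n" i] that(3,4) by simp
  have block_scaled: "b (k ^ i * N) = b (k ^ (s + i) * n)"
    if "n \<in> X" "b \<in> M" "k ^ s * n \<le> N" "N < k ^ s * (n + 1)" for b n N s i
  proof (rule block[OF that(1,2)])
    have e: "k ^ (s + i) * x = k ^ i * (k ^ s * x)" for x by (simp add: power_add)
    show "k ^ (s + i) * n \<le> k ^ i * N" unfolding e by (rule mult_le_mono2[OF that(3)])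
    show "k ^ i * N < k ^ (s + i) * (n + 1)" unfolding e by (rule mult_less_mono2[OF that(4)]) (use k in simp)
  qed
  obtain G where G: "finite G" "M = int_seq.span G" using fM unfolding fg_def by blast
  obtain E where E: "finite E" "E \<subseteq> X"
    and sep: "\<forall>f\<in>M. (\<forall>n\<in>E. f n = 0) \<longrightarrow> (\<forall>n\<in>X. f n = 0)"
    using finite_separating_points[OF G(1), of X] unfolding G(2) by (elim exE conjE)
  \<comment> \<open>The section of \<open>\<phi>\<close> at offset 0 lies in \<open>M\<close> and
    vanishes on \<open>E\<close>, hence on \<open>X\<close>; \<open>block0\<close> spreads these
    zeros over whole blocks.\<close>
  have rigid: "\<phi> \<simeq> 0" if "\<phi> \<in> M" "\<And>n. n \<in> E \<Longrightarrow> \<phi> (k ^ i * n) = 0" for \<phi> i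
  proof -
    have "(\<lambda>n. \<phi> (k ^ i * n)) \<in> M" using kclosed_power[OF kM that(1), of 0 i] k by simp
    from bspec[OF sep this] have z: "\<phi> (k ^ i * n) = 0" if "n \<in> X" for n using \<open>\<And>n. n \<in> E \<Longrightarrow> \<phi> (k ^ i * n) = 0\<close> that by blast
    have "null {n. \<phi> n \<noteq> 0}"
    proof (rule null_split[of "k ^ i"])
      fix r assume r: "r < k ^ i"
      show "null {n. k ^ i * n + r \<in> {n. \<phi> n \<noteq> 0}}"
        by (rule null_subset[OF nX]) (use z block0[OF _ that(1) r] in auto)
    qed (use k in simp)
    then show ?thesis by (simp add: asymp_eq_iff_null)
  qed
  define m where "m = Max (insert 1 E)"
  have Em: "0 < n \<and> n \<le> m" if "n \<in> E" for n using that E by (auto simp: m_def X_def)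
  \<comment> \<open>So close to 1 that for each \<open>n\<close> in \<open>E\<close> the intervals
    \<open>[n, n + 1)\<close> and \<open>u * [n, n + 1)\<close> overlap, and that a step by
    \<open>u\<close> cannot jump over \<open>[n, n + 1)\<close>.\<close>
  obtain i j where ij: "real k ^ i / real l ^ j \<noteq> 1" "\<bar>real k ^ i / real l ^ j - 1\<bar> < 1 / (real m + 1)"
    using near_one_power_ratio[OF k l cop, of "1 / (real m + 1)"] by auto
  define u where "u = real k ^ i / real l ^ j"
  have u0: "u > 0" "u \<noteq> 1" using ij k l by (auto simp: u_def)
  have um: "\<bar>u - 1\<bar> * (real n + 1) < 1" if "n \<in> E" for n
  proof -
    have "\<bar>u - 1\<bar> * (real n + 1) \<le> \<bar>u - 1\<bar> * (real m + 1)" using Em[OF that] by (intro mult_left_mono) auto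
    also have "\<dots> < 1" using ij(2) by (simp add: u_def field_simps)
    finally show ?thesis .
  qed
  text \<open>For \<open>k\<^sup>i\<close> close to \<open>l\<^sup>j\<close> the points \<open>k\<^sup>i N\<close> and \<open>l\<^sup>j N\<close> may lie in blocks on which all elements of \<open>M\<close> are
    constant; \<open>v\<close> plays the role of \<open>k\<^sup>i / l\<^sup>j\<close>.\<close>
  have hit: "\<forall>\<^sub>F s in sequentially. \<exists>N. N \<notin> Z \<and> k ^ s * x \<le> N \<and> N < k ^ s * (x + 1) \<and>
      k ^ (s + i') * y \<le> l ^ j' * N \<and> l ^ j' * N < k ^ (s + i') * (y + 1)"
    if "null Z" "v = real k ^ i' / real l ^ j'" "v * real y < real x + 1" "real x < v * (real y + 1)" for Z v i' j' x y
  proof -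
    define p where "p = max (real x) (v * real y)"
    define w where "w = min (real x + 1) (v * (real y + 1)) - p"
    have v0: "v > 0" using that(2) k l by simp
    have p: "p \<ge> 0" "w > 0" using that(3,4) v0 by (auto simp: p_def w_def)
    from null_avoid_block[OF that(1) p k] show ?thesis
    proof eventually_elim
      case (elim s)
      then obtain N where N: "N \<notin> Z" "p * real k ^ s \<le> real N" "real N < (p + w) * real k ^ s" by blast
      have ks: "real k ^ s > 0" and lj: "real l ^ j' > 0" using k l by auto
      have "real x * real k ^ s \<le> p * real k ^ s" using ks by (simp add: p_def)
      with N(2) have "real (k ^ s * x) \<le> real N" by (simp add: mult.commute)
      moreover have "(p + w) * real k ^ s \<le> (real x + 1) * real k ^ s" using ks by (simp add: w_def)
      with N(3) have "real N < real (k ^ s * (x + 1))" by (simp add: algebra_simps)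
      moreover have "v * real y * real k ^ s \<le> p * real k ^ s" using ks by (simp add: p_def)
      with N(2) have "v * real y * real k ^ s \<le> real N" by linarith
      then have "real (k ^ (s + i') * y) \<le> real (l ^ j' * N)"
        using lj by (simp add: that(2) field_simps power_add)
      moreover have "(p + w) * real k ^ s \<le> (v * (real y + 1)) * real k ^ s" using ks by (simp add: w_def)
      with N(3) have "real N < v * (real y + 1) * real k ^ s" by linarith
      then have "real (l ^ j' * N) < real (k ^ (s + i') * (y + 1))"
        using lj by (simp add: that(2) field_simps power_add)
      ultimately show ?case using N(1) by (metis of_nat_le_iff of_nat_less_iff)
    qed
  qed
  have same: "(\<lambda>n. a (k ^ i * n)) \<simeq> (\<lambda>n. a (l ^ j * n))"
  proof -
    \<comment> \<open>The representative \<open>h\<close> inherits slow variation from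
      \<open>a\<close>, so it lies in \<open>M\<close> and \<open>rigid\<close> can be applied to
      \<open>?\<phi>\<close>.\<close>
    obtain h where h: "h \<in> H" "(\<lambda>n. a (l ^ j * n)) \<simeq> h"
      using lclosed_power[OF H(4) _ H(2), of 0 j] l by auto
    have "(\<lambda>n. h (Suc n)) \<simeq> (\<lambda>n. a (l ^ j * Suc n))"
      using asymp_eq_affine[OF h(2), of 1 1] by (simp add: asymp_eq_sym)
    moreover have "(\<lambda>n. a (l ^ j * Suc n)) \<simeq> (\<lambda>n. a (l ^ j * n))"
      using asymp_shift_of_affine[OF lc, of "l ^ j" 0] l by simp
    ultimately have "(\<lambda>n. h (Suc n)) \<simeq> h" using h(2) asymp_eq_trans by blast
    then have hM: "h \<in> M" using h(1) M0(3) L(2) by (auto simp: M_def LC_def)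
    let ?\<phi> = "(\<lambda>n. a (k ^ i * n + 0)) - h"
    have \<phi>M: "?\<phi> \<in> M" by (rule int_seq.subspace_diff[OF sM kclosed_power[OF kM aM] hM]) (use k in simp)
    let ?Z = "{n. a (l ^ j * n) \<noteq> h n}"
    have nZ: "null ?Z" using h(2) by (simp add: asymp_eq_iff_null)
    have "\<forall>\<^sub>F s in sequentially. \<forall>n\<in>E. ?\<phi> (k ^ s * n) = 0"
    proof (rule eventually_ball_finite[OF E(1)], rule ballI)
      fix n assume n: "n \<in> E"
      have "u * real n < real n + 1" "real n < u * (real n + 1)"
      proof -
        have "\<bar>(u - 1) * (real n + 1)\<bar> < 1" using um[OF n] by (simp add: abs_mult)
        then have "- 1 < (u - 1) * (real n + 1)" "(u - 1) * (real n + 1) < 1" by linarith+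
        moreover have "u * real n \<le> real n" if "u < 1" using that by (simp add: mult_left_le_one_le u0(1) less_imp_le)
        ultimately show "u * real n < real n + 1" "real n < u * (real n + 1)"
          by (auto simp: algebra_simps) (cases "u < 1"; linarith)
      qed
      from hit[OF nZ u_def this] show "\<forall>\<^sub>F s in sequentially. ?\<phi> (k ^ s * n) = 0"
      proof eventually_elim
        case (elim s)
        then obtain N where N: "N \<notin> ?Z" "k ^ s * n \<le> N" "N < k ^ s * (n + 1)"
          "k ^ (s + i) * n \<le> l ^ j * N" "l ^ j * N < k ^ (s + i) * (n + 1)" by blast
        have nX': "n \<in> X" using n E(2) by blast
        \<comment> \<open>Both \<open>k ^ i * N\<close> and \<open>l ^ j * N\<close> lie in the
          block of \<open>n\<close> at scale \<open>s + i\<close>, where \<open>a\<close> is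
          constant.\<close>
        have "a (k ^ i * N) = a (k ^ (s + i) * n)" by (rule block_scaled[OF nX' aM N(2,3)])
        also have "\<dots> = a (l ^ j * N)" using block[OF nX' aM N(4,5)] by simp
        finally have "?\<phi> N = 0" using N(1) by simp
        then show "?\<phi> (k ^ s * n) = 0" using block[OF nX' \<phi>M N(2,3)] by simp
      qed
    qed
    then obtain s where "\<forall>n\<in>E. ?\<phi> (k ^ s * n) = 0" using eventually_happens'[OF sequentially_bot] by blast
    then have "?\<phi> \<simeq> 0" by (intro rigid[OF \<phi>M]) blast
    then have "(\<lambda>n. a (k ^ i * n)) \<simeq> h" by (simp add: asymp_eq_iff_null)
    then show ?thesis using asymp_eq_sym[OF h(2)] asymp_eq_trans by blast
  qed
  have same_pow: "(\<lambda>n. a (k ^ (i * t) * n)) \<simeq> (\<lambda>n. a (l ^ (j * t) * n))" for t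
  proof (induction t)
    case (Suc t)
    have "(\<lambda>n. a (k ^ (i * Suc t) * n)) \<simeq> (\<lambda>n. a (l ^ j * (k ^ (i * t) * n)))"
      using asymp_eq_affine[OF same, of "k ^ (i * t)" 0] k by (simp add: power_add mult_ac)
    moreover have "(\<lambda>n. a (l ^ j * (k ^ (i * t) * n))) \<simeq> (\<lambda>n. a (l ^ (j * Suc t) * n))"
      using asymp_eq_affine[OF Suc, of "l ^ j" 0] l by (simp add: power_add mult_ac)
    ultimately show ?case by (rule asymp_eq_trans)
  qed (simp add: asymp_eq_refl)
  \<comment> \<open>The overlap of \<open>[f, f + 1)\<close> with \<open>u ^ t * [g, g + 1)\<close>
    yields \<open>N\<close> for which \<open>k ^ (i * t) * N\<close> and
    \<open>l ^ (j * t) * N\<close> lie in the blocks of \<open>f\<close> and of \<open>g\<close> at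
    one scale; \<open>same_pow\<close> equates the two values.\<close>
  have eq1: "\<forall>\<^sub>F S in sequentially. a (k ^ S * f) = a (k ^ S * g)"
    if f: "f \<in> E" and g: "g \<in> E" and ord: "(u > 1 \<and> g \<le> f) \<or> (u < 1 \<and> f \<le> g)" for f g
  proof -
    obtain t where t: "u ^ t * real g < real f + 1" "real f < u ^ t * (real g + 1)"
      using power_ratio_overlap[OF u0 um[OF f] ord] Em[OF g] by blast
    let ?Z = "{n. a (k ^ (i * t) * n) \<noteq> a (l ^ (j * t) * n)}"
    have nZ: "null ?Z" using same_pow[of t] by (simp add: asymp_eq_iff_null)
    have "u ^ t = real k ^ (i * t) / real l ^ (j * t)" by (simp add: u_def power_divide power_mult)
    from hit[OF nZ this t]
    have "\<forall>\<^sub>F s in sequentially. a (k ^ (s + i * t) * f) = a (k ^ (s + i * t) * g)"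
    proof eventually_elim
      case (elim s)
      then obtain N where N: "N \<notin> ?Z" "k ^ s * f \<le> N" "N < k ^ s * (f + 1)"
        "k ^ (s + i * t) * g \<le> l ^ (j * t) * N" "l ^ (j * t) * N < k ^ (s + i * t) * (g + 1)" by blast
      have X': "f \<in> X" "g \<in> X" using f g E(2) by blast+
      have "a (k ^ (i * t) * N) = a (k ^ (s + i * t) * f)" by (rule block_scaled[OF X'(1) aM N(2,3)])
      moreover have "a (l ^ (j * t) * N) = a (k ^ (s + i * t) * g)" by (rule block[OF X'(2) aM N(4,5)])
      ultimately show ?case using N(1) by simp
    qed
    then show ?thesis by (rule eventually_sequentially_seg[THEN iffD1])
  qed
  have "\<forall>\<^sub>F S in sequentially. \<forall>f\<in>E. \<forall>g\<in>E. a (k ^ S * f) = a (k ^ S * g)"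
  proof (intro eventually_ball_finite[OF E(1)] ballI)
    fix f g assume fg: "f \<in> E" "g \<in> E"
    show "\<forall>\<^sub>F S in sequentially. a (k ^ S * f) = a (k ^ S * g)"
    proof (cases "(u > 1 \<and> g \<le> f) \<or> (u < 1 \<and> f \<le> g)")
      case True
      then show ?thesis using eq1 fg by blast
    next
      case False
      then have "(u > 1 \<and> f \<le> g) \<or> (u < 1 \<and> g \<le> f)" using u0(2) by auto
      then have "\<forall>\<^sub>F S in sequentially. a (k ^ S * g) = a (k ^ S * f)" using eq1 fg by blast
      then show ?thesis by eventually_elim simp
    qed
  qed
  then obtain S where S: "\<forall>f\<in>E. \<forall>g\<in>E. a (k ^ S * f) = a (k ^ S * g)"
    using eventually_happens'[OF sequentially_bot] by blast
  then obtain c where c: "\<And>f. f \<in> E \<Longrightarrow> a (k ^ S * f) = c" by blast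
  have "a - (\<lambda>_. c) \<simeq> 0"
    by (rule rigid[of _ S]) (use c int_seq.subspace_diff[OF sM aM constM] in auto)
  then show ?thesis by (auto simp: asymp_eq_iff_null)
qed

section \<open>Polynomials in the shift operator and quasi-polynomials\<close>

text \<open>The operator \<open>P(S)\<close> for the shift \<open>S\<close>. The ring is generic
  because recurrences need integer coefficients and roots need complex ones.\<close>

definition shift_poly :: "'a::comm_ring_1 poly \<Rightarrow> (nat \<Rightarrow> 'a) \<Rightarrow> nat \<Rightarrow> 'a"
  where "shift_poly P x n = (\<Sum>i\<le>degree P. coeff P i * x (n + i))"

lemma shift_poly_bound: "degree P \<le> N \<Longrightarrow> shift_poly P x n = (\<Sum>i\<le>N. coeff P i * x (n + i))"
  unfolding shift_poly_def by (rule sum.mono_neutral_left) (auto simp: coeff_eq_0)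

lemma shift_poly_0 [simp]: "shift_poly 0 x = (\<lambda>_. 0)"
  by (simp add: shift_poly_def fun_eq_iff)

lemma shift_poly_pCons: "shift_poly (pCons c P) x n = c * x n + shift_poly P x (Suc n)"
proof (cases "P = 0")
  case False
  then show ?thesis by (simp add: shift_poly_def sum.atMost_Suc_shift del: sum.atMost_Suc)
qed (simp add: shift_poly_def)

lemma shift_poly_add: "shift_poly (P + Q) x n = shift_poly P x n + shift_poly Q x n"
proof -
  let ?N = "max (degree P) (degree Q)"
  have "shift_poly (P + Q) x n = (\<Sum>i\<le>?N. coeff (P + Q) i * x (n + i))"
    by (rule shift_poly_bound) (simp add: degree_add_le_max)
  then show ?thesis
    by (simp add: shift_poly_bound[of P ?N] shift_poly_bound[of Q ?N] distrib_right sum.distrib)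
qed

lemma shift_poly_smult: "shift_poly (smult c P) x n = c * shift_poly P x n"
  by (simp add: shift_poly_bound[of "smult c P" "degree P"] shift_poly_bound[of P "degree P"] degree_smult_le
      sum_distrib_left mult.assoc)

lemma shift_poly_diff: "shift_poly (P - Q) x n = shift_poly P x n - shift_poly Q x n"
  using shift_poly_add[of P "- Q" x n] shift_poly_smult[of "- 1" Q x n] by simp

lemma shift_poly_sum: "shift_poly (\<Sum>i\<in>I. P i) x n = (\<Sum>i\<in>I. shift_poly (P i) x n)"
  by (induction I rule: infinite_finite_induct) (auto simp: shift_poly_add)

lemma shift_poly_mult: "shift_poly (P * Q) x n = shift_poly P (shift_poly Q x) n"
  by (induction P arbitrary: n) (simp_all add: shift_poly_pCons shift_poly_add shift_poly_smult)

lemma shift_poly_monom: "shift_poly (monom c i) x n = c * x (n + i)"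
  by (induction i arbitrary: n) (simp_all add: monom_0 monom_Suc shift_poly_pCons)

lemma shift_poly_1 [simp]: "shift_poly 1 x = x"
  using shift_poly_monom[of 1 0 x] by (simp add: fun_eq_iff monom_0 one_pCons)

text \<open>A shift by \<open>k\<close> stays in its class modulo \<open>k\<close> and acts there as
  a single shift of the section. Hence \<open>P(X^k)\<close> annihilates whatever has all its
  sections annihilated by \<open>P\<close>.\<close>

lemma shift_poly_pcompose_monom: "shift_poly (pcompose P (monom 1 k)) x (k * n + r) = shift_poly P (\<lambda>n. x (k * n + r)) n"
proof (induction P arbitrary: n)
  case (pCons c P)
  show ?case using pCons(2)[of "Suc n"]
    by (simp add: pcompose_pCons shift_poly_add shift_poly_pCons shift_poly_mult shift_poly_monom algebra_simps)
qed simp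

lemma shift_poly_linear: "shift_poly P (\<lambda>n. c * x n + y n) n = c * shift_poly P x n + shift_poly P y n"
  by (simp add: shift_poly_def distrib_left sum.distrib sum_distrib_left mult_ac)

section \<open>Iterated differences and quasi-polynomials\<close>

definition diffq :: "nat \<Rightarrow> (nat \<Rightarrow> 'a::comm_ring_1) \<Rightarrow> nat \<Rightarrow> 'a"
  where "diffq q x = (\<lambda>n. x (n + q) - x n)"

lemma diffq_shift_poly: "diffq q x = shift_poly (monom 1 q - 1) x"
  by (auto simp: diffq_def shift_poly_diff shift_poly_monom)

lemma funpow_diffq_shift_poly: "(diffq q ^^ m) x = shift_poly ((monom 1 q - 1) ^ m) x"
proof (induction m)
  case (Suc m)
  then show ?case by (auto simp: diffq_shift_poly shift_poly_mult)
qed (simp only: funpow_0 power_0 shift_poly_1)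

lemma funpow_diffq_linear: "(diffq q ^^ m) (seq_scale c x + y) = seq_scale c ((diffq q ^^ m) x) + (diffq q ^^ m) y"
  using shift_poly_linear[of "(monom 1 q - 1) ^ m" c x y]
  unfolding funpow_diffq_shift_poly by (auto simp: seq_scale_def plus_fun_def)

text \<open>For \<open>q > 0\<close>, the sequences that are polynomial of degree below
  \<open>m\<close> on each residue class modulo \<open>q\<close>.\<close>

definition quasi_poly :: "nat \<Rightarrow> nat \<Rightarrow> (nat \<Rightarrow> int) set"
  where "quasi_poly q m = {x. (diffq q ^^ m) x = 0}"

lemma funpow_diffq_zero: "(diffq q ^^ m) 0 = (0 :: nat \<Rightarrow> int)"
  by (induction m) (auto simp: diffq_def fun_eq_iff)

lemma subspace_quasi_poly: "int_seq.subspace (quasi_poly q m)"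
proof (rule int_seq.subspaceI)
  show "0 \<in> quasi_poly q m" by (simp add: quasi_poly_def funpow_diffq_zero)
  show "x + y \<in> quasi_poly q m" if "x \<in> quasi_poly q m" "y \<in> quasi_poly q m" for x y
    using funpow_diffq_linear[where c = 1 and x = x and y = y] that by (simp add: quasi_poly_def)
  show "seq_scale c x \<in> quasi_poly q m" if "x \<in> quasi_poly q m" for x c
    using funpow_diffq_linear[where c = c and x = x and y = 0] that
    by (simp add: quasi_poly_def funpow_diffq_zero)
qed

lemma quasi_poly_Suc_iff: "x \<in> quasi_poly q (Suc m) \<longleftrightarrow> diffq q x \<in> quasi_poly q m"
  unfolding quasi_poly_def by (simp add: funpow_Suc_right del: funpow.simps)

lemma quasi_poly_mono: "quasi_poly q m \<subseteq> quasi_poly q (m + i)"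
proof
  fix x assume "x \<in> quasi_poly q m"
  then have "(diffq q ^^ i) ((diffq q ^^ m) x) = 0" by (simp add: quasi_poly_def funpow_diffq_zero)
  then show "x \<in> quasi_poly q (m + i)" by (simp add: quasi_poly_def funpow_add add.commute[of m i])
qed

text \<open>The right inverse of \<open>diffq q\<close> normalised to vanish for
  \<open>n < q\<close>.\<close>

definition antidiff :: "nat \<Rightarrow> (nat \<Rightarrow> int) \<Rightarrow> nat \<Rightarrow> int"
  where "antidiff q b n = (\<Sum>i<n div q. b (n mod q + q * i))"

lemma diffq_antidiff: "q > 0 \<Longrightarrow> diffq q (antidiff q b) = b"
  by (auto simp: diffq_def antidiff_def fun_eq_iff)

lemma diffq_periodic:
  assumes "diffq q x = 0"
  shows "x n = x (n mod q)"
proof -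
  have "x (m + q) = x m" for m using assms by (simp add: diffq_def fun_eq_iff)
  note step = this
  have "x (r + q * i) = x r" for r i
  proof (induction i)
    case (Suc i)
    then show ?case using step[of "r + q * i"] by (simp add: ac_simps)
  qed simp
  from this[of "n mod q" "n div q"] show ?thesis by simp
qed

text \<open>Up to a \<open>q\<close>-periodic sequence, a quasi-polynomial is an antidifference of
  one of lower order. This puts \<open>quasi_poly q (Suc m)\<close> inside a finitely generated
  module, which suffices.\<close>

lemma fg_quasi_poly:
  assumes "q > 0"
  shows "fg (quasi_poly q m)"
proof (induction m)
  case 0
  have "quasi_poly q 0 = {0}" by (auto simp: quasi_poly_def)
  then show ?case unfolding fg_def by (intro exI[of _ "{}"]) auto
next
  case (Suc m)
  then obtain B where B: "finite B" "quasi_poly q m = int_seq.span B" unfolding fg_def by blast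
  let ?ind = "\<lambda>r n. if n mod q = r then 1 else 0 :: int"
  let ?G = "antidiff q ` B \<union> ?ind ` {..<q}"
  have lift: "\<exists>z\<in>int_seq.span (antidiff q ` B). diffq q z = y" if "y \<in> int_seq.span B" for y
    using that
  proof (induction y rule: int_seq.span_induct_alt)
    case base
    show ?case by (rule bexI[OF _ int_seq.span_zero]) (auto simp: diffq_def)
  next
    case (step c x y)
    then obtain z where z: "z \<in> int_seq.span (antidiff q ` B)" "diffq q z = y" by blast
    have "diffq q (seq_scale c (antidiff q x) + z) = seq_scale c x + y"
      using diffq_antidiff[OF assms, of x] z(2) by (auto simp: diffq_def seq_scale_def fun_eq_iff algebra_simps)
    moreover have "seq_scale c (antidiff q x) + z \<in> int_seq.span (antidiff q ` B)"
      using step.hyps z(1) by (intro int_seq.span_add[OF int_seq.span_scale[OF int_seq.span_base]]) auto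
    ultimately show ?case by blast
  qed
  have "quasi_poly q (Suc m) \<subseteq> int_seq.span ?G"
  proof
    fix x assume "x \<in> quasi_poly q (Suc m)"
    then have "diffq q x \<in> int_seq.span B" unfolding B(2)[symmetric] by (simp add: quasi_poly_Suc_iff)
    from lift[OF this] obtain z where z: "z \<in> int_seq.span (antidiff q ` B)" "diffq q z = diffq q x" by blast
    let ?p = "x - z"
    have "diffq q ?p = 0" using z(2) by (auto simp: diffq_def fun_eq_iff algebra_simps)
    then have per: "?p n = ?p (n mod q)" for n by (rule diffq_periodic)
    have "?p = (\<Sum>r<q. seq_scale (?p r) (?ind r))"
    proof
      fix n
      have "(\<Sum>r\<in>A. seq_scale (?p r) (?ind r)) n = (\<Sum>r\<in>A. seq_scale (?p r) (?ind r) n)" if "finite A" for A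
        using that by (induction A rule: finite_induct) auto
      then have "(\<Sum>r<q. seq_scale (?p r) (?ind r)) n = (\<Sum>r<q. if n mod q = r then ?p r else 0)"
        by (simp add: seq_scale_def if_distrib cong: if_cong)
      also have "\<dots> = ?p (n mod q)" using assms by simp
      finally show "?p n = (\<Sum>r<q. seq_scale (?p r) (?ind r)) n" using per by simp
    qed
    also have "\<dots> \<in> int_seq.span ?G"
      by (intro int_seq.span_sum int_seq.span_scale int_seq.span_base) auto
    finally have "?p \<in> int_seq.span ?G" .
    moreover have "z \<in> int_seq.span ?G" using z(1) int_seq.span_mono[of "antidiff q ` B" ?G] by blast
    ultimately have "?p + z \<in> int_seq.span ?G" by (rule int_seq.span_add)
    then show "x \<in> int_seq.span ?G" by simp
  qed
  then show ?case by (intro fg_submodule_span[OF _ subspace_quasi_poly, of ?G]) (use B(1) in auto)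
qed

text \<open>A step of \<open>q\<close> in the section is \<open>k\<close> steps of \<open>q\<close>
  in \<open>x\<close>, so the difference of the section telescopes into a sum of \<open>k\<close>
  sections of \<open>diffq q x\<close>.\<close>

lemma quasi_poly_affine:
  "x \<in> quasi_poly q m \<Longrightarrow> (\<lambda>n. x (k * n + r)) \<in> quasi_poly q m"
proof (induction m arbitrary: x r)
  case 0
  then show ?case by (auto simp: quasi_poly_def fun_eq_iff)
next
  case (Suc m)
  let ?y = "\<lambda>i n. diffq q x (k * n + (r + q * i))"
  have "diffq q x \<in> quasi_poly q m" using Suc.prems by (simp add: quasi_poly_Suc_iff)
  then have "?y i \<in> quasi_poly q m" for i by (rule Suc.IH)
  then have "(\<Sum>i<j. ?y i) \<in> quasi_poly q m" for j by (intro int_seq.subspace_sum[OF subspace_quasi_poly])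
  moreover have "(\<Sum>i<j. ?y i) n = x (k * n + r + q * j) - x (k * n + r)" for j n
    by (induction j) (auto simp: diffq_def algebra_simps)
  then have "(\<Sum>i<k. ?y i) = diffq q (\<lambda>n. x (k * n + r))"
    by (auto simp: diffq_def fun_eq_iff algebra_simps)
  ultimately show ?case unfolding quasi_poly_Suc_iff by metis
qed

lemma kclosed_quasi_poly: "kclosed k (quasi_poly q m)"
  unfolding kclosed_def
proof (intro ballI allI impI)
  fix b r assume "b \<in> quasi_poly q m"
  then show "(\<lambda>n. b (k * n + r)) \<in> quasi_poly q m" by (rule quasi_poly_affine)
qed

lemma kreg_quasi_poly: "q > 0 \<Longrightarrow> x \<in> quasi_poly q m \<Longrightarrow> kreg k x"
  unfolding kreg_def by (intro exI[of _ "quasi_poly q m"] conjI fg_quasi_poly kclosed_quasi_poly)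

lemma bireg_quasi_poly:
  assumes "q > 0" "x \<in> quasi_poly q m"
  shows "bireg k l x"
  unfolding bireg_def
proof (intro exI[of _ "quasi_poly q m"] conjI ballI)
  show "lclosed l (quasi_poly q m)"
    unfolding lclosed_def
  proof (intro ballI allI impI)
    fix b r assume "b \<in> quasi_poly q m"
    then have "(\<lambda>n. b (l * n + r)) \<in> quasi_poly q m" by (rule quasi_poly_affine)
    then show "\<exists>c\<in>quasi_poly q m. (\<lambda>n. b (l * n + r)) \<simeq> c" using asymp_eq_refl by blast
  qed
qed (use assms in \<open>auto intro: fg_quasi_poly kreg_quasi_poly\<close>)

lemma quasi_poly_linear_recurrence:
  assumes "q > 0" "x \<in> quasi_poly q m"
  shows "satisfies_linear_recurrence x"
proof -
  \<comment> \<open>The polynomial is monic, and the exponent \<open>Suc m\<close> makes its degree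
    positive even for \<open>m = 0\<close>, as a recurrence of order at least 1 requires.\<close>
  let ?P = "(monom 1 q - 1) ^ Suc m :: int poly"
  define d where "d = degree ?P"
  have "degree (monom 1 q - 1 :: int poly) = q"
    using assms(1) degree_add_eq_left[of "- 1" "monom 1 q :: int poly"] by (simp add: degree_monom_eq)
  then have d1: "d \<ge> 1" using assms(1) unfolding d_def by (subst degree_power_eq) auto
  have "lead_coeff (monom 1 q - 1 :: int poly) = 1"
    using assms(1) \<open>degree (monom 1 q - 1 :: int poly) = q\<close> by (simp)
  then have lc: "coeff ?P d = 1" unfolding d_def by (simp add: lead_coeff_power del: power_Suc)
  have "x \<in> quasi_poly q (Suc m)" using assms(2) quasi_poly_mono[of q m 1] by auto
  then have z: "shift_poly ?P x n = 0" for n unfolding quasi_poly_def funpow_diffq_shift_poly by (simp add: fun_eq_iff)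
  define t where "t i = - coeff ?P (d - i)" for i
  have "x (n + d) = (\<Sum>i = 1..d. t i * x (n + d - i))" for n
  proof -
    have "0 = (\<Sum>i\<le>d. coeff ?P i * x (n + i))" using z[of n] by (simp add: shift_poly_def d_def)
    also have "\<dots> = x (n + d) + (\<Sum>i<d. coeff ?P i * x (n + i))"
      using lc by (simp add: lessThan_Suc_atMost[symmetric] del: power_Suc)
    also have "(\<Sum>i<d. coeff ?P i * x (n + i)) = (\<Sum>i = 1..d. coeff ?P (d - i) * x (n + d - i))"
      by (rule sum.reindex_bij_witness[of _ "\<lambda>i. d - i" "\<lambda>i. d - i"]) auto
    also have "\<dots> = - (\<Sum>i = 1..d. t i * x (n + d - i))" by (simp add: t_def sum_negf)
    finally show ?thesis by simp
  qed
  with d1 show ?thesis unfolding satisfies_linear_recurrence_def by blast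
qed

lemma asymp_quasi_poly:
  assumes k: "k \<ge> 2" and l: "l \<ge> 2" and cop: "coprime k l" and q: "q > 0"
  shows "bireg k l a \<Longrightarrow> (diffq q ^^ m) a \<simeq> 0 \<Longrightarrow> \<exists>m'. \<exists>x\<in>quasi_poly q m'. a \<simeq> x"
proof (induction m arbitrary: a)
  case 0
  have "0 \<in> quasi_poly q 0" by (simp add: quasi_poly_def)
  moreover have "a \<simeq> 0" using 0(2) by (simp add: zero_fun_def)
  ultimately show ?case by blast
next
  case (Suc m)
  have "bireg k l (\<lambda>n. a (1 * n + q))" using k l Suc.prems(1) by (intro bireg_affine) auto
  from bireg_add[OF this bireg_scale[OF Suc.prems(1), of "- 1"]]
  have "bireg k l (diffq q a)" by (simp add: diffq_def seq_scale_def plus_fun_def)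
  moreover have "(diffq q ^^ m) (diffq q a) \<simeq> 0"
    using Suc.prems(2) by (simp add: funpow_Suc_right zero_fun_def del: funpow.simps)
  ultimately obtain m' b where b: "b \<in> quasi_poly q m'" "diffq q a \<simeq> b" using Suc.IH by blast
  define z where "z = antidiff q b"
  have zq: "z \<in> quasi_poly q (Suc m')"
    using b(1) by (simp add: quasi_poly_Suc_iff z_def diffq_antidiff[OF q])
  \<comment> \<open>Subtracting the antidifference leaves a sequence asymptotically invariant under
    the shift by \<open>q\<close>; its sections modulo \<open>q\<close> vary slowly, so
    \<open>asymp_constant\<close> applies to each.\<close>
  define e where "e = a + seq_scale (- 1) z"
  have e: "bireg k l e"
    unfolding e_def by (rule bireg_add[OF Suc.prems(1) bireg_scale[OF bireg_quasi_poly[OF q zq]]])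
  have "diffq q z = b" by (simp add: z_def diffq_antidiff[OF q])
  then have "(\<lambda>n. e (n + q)) \<simeq> e"
    using b(2) unfolding asymp_eq_iff_null
    by (elim null_subset) (auto simp: e_def diffq_def seq_scale_def)
  then have sh: "(\<lambda>n. e (q * Suc n + r)) \<simeq> (\<lambda>n. e (q * n + r))" for r
    using asymp_eq_affine[OF _ q, of "\<lambda>n. e (n + q)" e r] by (simp add: algebra_simps)
  have "\<exists>c. (\<lambda>n. e (q * n + r)) \<simeq> (\<lambda>_. c)" for r
    by (rule asymp_constant[OF k l cop bireg_affine sh]) (use k l q e in auto)
  then obtain c where c: "\<And>r. (\<lambda>n. e (q * n + r)) \<simeq> (\<lambda>_. c r)" by metis
  define p where "p n = c (n mod q)" for n
  have "p \<in> quasi_poly q 1" by (auto simp: quasi_poly_def diffq_def p_def)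
  then have pq: "p \<in> quasi_poly q (Suc m')" using quasi_poly_mono[of q 1 m'] by auto
  have "e \<simeq> p"
    unfolding asymp_eq_iff_null
  proof (rule null_split[OF q])
    fix r assume "r < q"
    then show "null {n. q * n + r \<in> {n. e n \<noteq> p n}}"
      using c[of r] by (simp add: asymp_eq_iff_null p_def)
  qed
  from asymp_eq_add[OF this asymp_eq_refl[of z]] have "a \<simeq> p + z"
    by (simp add: e_def seq_scale_def asymp_eq_iff_null)
  then show ?case using int_seq.subspace_add[OF subspace_quasi_poly pq zq] by blast
qed

section \<open>Vanishing along residue classes\<close>

text \<open>In base \<open>K\<close> every prefix \<open>n'\<close> has a next digit that leads into
  the class of \<open>c\<close>, because \<open>K \<ge> q\<close> consecutive integers meet all
  classes. So each of the \<open>J\<close> steps keeps at most \<open>K - 1\<close> of the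
  \<open>K\<close> digits.\<close>

lemma card_avoiding_prefixes:
  assumes "q > 0" "q \<le> K"
  shows "card ({n. \<forall>t<J. (n div K ^ t) mod q \<noteq> c mod q} \<inter> {..<K ^ J * m}) \<le> (K - 1) ^ J * m"
proof (induction J)
  case (Suc J)
  let ?V = "\<lambda>J. {n. \<forall>t<J. (n div K ^ t) mod q \<noteq> c mod q} \<inter> {..<K ^ J * m}"
  let ?D = "\<lambda>n'. {d. d < K \<and> (K * n' + d) mod q \<noteq> c mod q}"
  have K: "K > 0" using assms by simp
  have "?V (Suc J) \<subseteq> (\<lambda>(n', d). K * n' + d) ` (SIGMA n' : ?V J. ?D n')"
  proof
    fix n assume n: "n \<in> ?V (Suc J)"
    have "(n div K) div K ^ t = n div K ^ Suc t" for t by (simp add: div_mult2_eq)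
    then have "\<forall>t<J. ((n div K) div K ^ t) mod q \<noteq> c mod q" using n by (simp del: power_Suc)
    moreover have "n div K < K ^ J * m"
      using n K by (intro less_mult_imp_div_less) (simp add: mult_ac)
    moreover have "n mod K \<in> ?D (n div K)" using n K by (auto dest: spec[of _ 0])
    ultimately have "(n div K, n mod K) \<in> (SIGMA n' : ?V J. ?D n')" by blast
    then show "n \<in> (\<lambda>(n', d). K * n' + d) ` (SIGMA n' : ?V J. ?D n')"
      by (rule rev_image_eqI) simp
  qed
  then have "card (?V (Suc J)) \<le> card ((\<lambda>(n', d). K * n' + d) ` (SIGMA n' : ?V J. ?D n'))"
    by (intro card_mono finite_imageI finite_SigmaI) auto
  also have "\<dots> \<le> card (SIGMA n' : ?V J. ?D n')"
    by (intro card_image_le finite_SigmaI) auto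
  also have "\<dots> = (\<Sum>n'\<in>?V J. card (?D n'))" by (subst card_SigmaI) auto
  also have "\<dots> \<le> (\<Sum>n'\<in>?V J. K - 1)"
  proof (rule sum_mono)
    fix n'
    define x where "x = (K * n') mod q"
    \<comment> \<open>The digit congruent to \<open>c - K * n'\<close> modulo \<open>q\<close>;
      adding \<open>q - x\<close> avoids truncated subtraction.\<close>
    define d where "d = (c mod q + (q - x)) mod q"
    have x: "x < q" using assms(1) by (simp add: x_def)
    have "(K * n' + d) mod q = (x + (c mod q + (q - x))) mod q"
      unfolding d_def by (metis x_def mod_add_left_eq mod_add_right_eq)
    also have "\<dots> = c mod q" using x by simp
    finally have dc: "(K * n' + d) mod q = c mod q" .
    have dK: "d < K" using assms by (auto simp: d_def intro: order.strict_trans2[OF mod_less_divisor])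
    have "card (?D n') \<le> card ({..<K} - {d})" using dc by (intro card_mono) auto
    then show "card (?D n') \<le> K - 1" using dK by simp
  qed
  also have "\<dots> = card (?V J) * (K - 1)" by simp
  also have "\<dots> \<le> (K - 1) ^ J * m * (K - 1)" by (rule mult_le_mono1[OF Suc.IH])
  finally show ?case by (simp add: mult_ac)
qed simp

text \<open>Numbers with none of the first \<open>J\<close> truncations in the class have upper
  density at most \<open>((K - 1) / K) ^ J\<close>; the remaining elements of \<open>Z\<close> lie
  in finitely many null sets.\<close>

lemma null_by_prefixes:
  assumes "q > 0" "q \<le> K" "\<And>t. null {n \<in> Z. (n div K ^ t) mod q = c mod q}"
  shows "null Z"
proof (rule null_approx)
  fix e :: real assume e: "e > 0"
  have K: "K > 0" using assms by simp
  obtain J where J: "(real (K - 1) / real K) ^ J < e"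
    using real_arch_pow_inv[OF e, of "real (K - 1) / real K"] K by auto
  let ?T = "\<Union>t<J. {n \<in> Z. (n div K ^ t) mod q = c mod q}"
  let ?U = "{n. \<forall>t<J. (n div K ^ t) mod q \<noteq> c mod q}"
  have "null ?T" by (rule null_UN) (use assms(3) in auto)
  moreover have "Z \<subseteq> ?T \<union> ?U" by auto
  moreover have "real (card (?U \<inter> {..<N})) \<le> e * real N + real ((K - 1) ^ J)" for N
  proof -
    have "N < K ^ J * (N div K ^ J + 1)"
      using dividend_less_times_div[of "K ^ J" N] K by (simp add: algebra_simps)
    then have "card (?U \<inter> {..<N}) \<le> card (?U \<inter> {..<K ^ J * (N div K ^ J + 1)})"
      by (intro card_mono) auto
    also have "\<dots> \<le> (K - 1) ^ J * (N div K ^ J + 1)" by (rule card_avoiding_prefixes[OF assms(1,2)])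
    finally have "real (card (?U \<inter> {..<N})) \<le> real ((K - 1) ^ J * (N div K ^ J + 1))" by (rule of_nat_mono)
    also have "\<dots> = real (K - 1) ^ J * real (N div K ^ J) + real ((K - 1) ^ J)" by (simp add: algebra_simps)
    also have "real (K - 1) ^ J * real (N div K ^ J) \<le> real (K - 1) ^ J * (real N / real (K ^ J))"
      by (intro mult_left_mono of_nat_div_le_of_nat) auto
    also have "\<dots> = (real (K - 1) / real K) ^ J * real N" by (simp add: power_divide)
    also have "\<dots> \<le> e * real N" using J by (intro mult_right_mono) auto
    finally show ?thesis by simp
  qed
  ultimately show "\<exists>T U C. null T \<and> Z \<subseteq> T \<union> U \<and> (\<forall>N. real (card (U \<inter> {..<N})) \<le> e * real N + C)"
    by blast
qed

section \<open>Residue classes under affine maps\<close>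

text \<open>Invertibility of \<open>K\<close> modulo \<open>q\<close> gives \<open>c\<close>, and
  invertibility modulo \<open>q0\<close> identifies its class there with that of
  \<open>n\<close>.\<close>

lemma coprime_residue_lift:
  fixes K q q0 :: nat
  assumes "coprime K q" "q0 dvd q" "q > 0" "(K * n + r) mod q0 = \<rho> mod q0"
  obtains c where "c mod q0 = n mod q0" "(K * c + r) mod q = \<rho> mod q"
proof -
  obtain x where x: "[K * x = 1] (mod q)" using cong_solve_coprime_nat[OF assms(1)] by auto
  \<comment> \<open>The summand \<open>r * (q - 1)\<close> stands for \<open>- r\<close> modulo
    \<open>q\<close>.\<close>
  define c where "c = x * (\<rho> + r * (q - 1))"
  have "[K * x * (\<rho> + r * (q - 1)) + r = 1 * (\<rho> + r * (q - 1)) + r] (mod q)"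
    by (intro cong_add cong_mult x cong_refl)
  moreover have "1 * (\<rho> + r * (q - 1)) + r = \<rho> + r * q" using assms(3) by (cases q) (auto simp: algebra_simps)
  ultimately have "[K * x * (\<rho> + r * (q - 1)) + r = \<rho> + r * q] (mod q)" by (simp only:)
  then have c: "[K * c + r = \<rho>] (mod q)" unfolding c_def by (simp add: cong_def mult.assoc)
  then have "[K * c + r = \<rho>] (mod q0)" using assms(2) by (rule cong_dvd_modulus_nat)
  also have "[\<rho> = K * n + r] (mod q0)" using assms(4) by (simp add: cong_def)
  finally have "[K * c = K * n] (mod q0)" by (simp add: cong_add_rcancel_nat)
  moreover have "coprime K q0" by (rule coprime_divisors[OF dvd_refl assms(2,1)])
  ultimately have "[c = n] (mod q0)" by (simp add: cong_mult_lcancel_nat)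
  with c show ?thesis using that by (simp add: cong_def)
qed

lemma residue_cancel:
  fixes K q :: nat
  assumes "coprime K q" "(K * n + r) mod q = (K * n' + r) mod q"
  shows "n mod q = n' mod q"
proof -
  have "[K * n + r = K * n' + r] (mod q)" using assms(2) by (simp only: cong_def)
  then have "[K * n = K * n'] (mod q)" by (simp only: cong_add_rcancel_nat)
  then have "[n = n'] (mod q)" using assms(1) by (simp only: cong_mult_lcancel_nat)
  then show ?thesis by (simp only: cong_def)
qed

lemma affine_mod_eq:
  fixes K q :: nat
  shows "n mod q = n' mod q \<Longrightarrow> (K * n + r) mod q = (K * n' + r) mod q"
  by (metis mod_add_left_eq mod_mult_right_eq)

definition zero_on :: "nat \<Rightarrow> nat \<Rightarrow> (nat \<Rightarrow> int) \<Rightarrow> bool"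
  where "zero_on q c b \<longleftrightarrow> null {n. n mod q = c mod q \<and> b n \<noteq> 0}"

lemma zero_on_dvd:
  assumes "zero_on q c b" "q dvd q'" "c' mod q = c mod q"
  shows "zero_on q' c' b"
  using assms(1) unfolding zero_on_def
proof (rule null_subset)
  have "n mod q = c' mod q" if "n mod q' = c' mod q'" for n
    using that assms(2) by (metis mod_mod_cancel)
  then show "{n. n mod q' = c' mod q' \<and> b n \<noteq> 0} \<subseteq> {n. n mod q = c mod q \<and> b n \<noteq> 0}"
    using assms(3) by auto
qed

lemma subspace_zero_on: "int_seq.subspace {b. zero_on q c b}"
proof (rule int_seq.subspaceI)
  show "0 \<in> {b. zero_on q c b}" by (simp add: zero_on_def null_empty)
  show "x + y \<in> {b. zero_on q c b}" if "x \<in> {b. zero_on q c b}" "y \<in> {b. zero_on q c b}" for x y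
    using null_Un[of "{n. n mod q = c mod q \<and> x n \<noteq> 0}" "{n. n mod q = c mod q \<and> y n \<noteq> 0}"] that
    by (auto simp: zero_on_def elim!: null_subset)
  show "seq_scale t x \<in> {b. zero_on q c b}" if "x \<in> {b. zero_on q c b}" for t x
    using that by (auto simp: zero_on_def seq_scale_def elim!: null_subset)
qed

text \<open>Among the submodules of elements vanishing almost everywhere on a class modulo a power of \<open>l\<close>
  pick a maximal one. Since digits in base \<open>k\<close> distribute over all classes modulo \<open>q\<close>, this modulus then
  governs vanishing along every other class.\<close>

lemma stable_modulus:
  assumes k: "k \<ge> 2" and l: "l > 0" and cop: "coprime k l" and M: "fg M" "kclosed k M"
  obtains j0 where "\<And>A i j \<rho>. (\<And>r. r < k ^ i \<Longrightarrow> (\<lambda>n. A (k ^ i * n + r)) \<in> M) \<Longrightarrow> j0 \<le> j \<Longrightarrow>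
    zero_on (l ^ j) \<rho> A \<Longrightarrow> zero_on (l ^ j0) \<rho> A"
proof -
  define S where "S c j = M \<inter> {b. zero_on (l ^ j) c b}" for c j
  have "int_seq.subspace (S c j) \<and> S c j \<subseteq> M" for c j
    unfolding S_def using int_seq.subspace_inter[OF fg_subspace[OF M(1)] subspace_zero_on] by blast
  then have F: "\<And>N. N \<in> {S c j | c j. True} \<Longrightarrow> int_seq.subspace N \<and> N \<subseteq> M" by blast
  obtain N where "N \<in> {S c j | c j. True}" and Nmax: "\<And>N'. N' \<in> {S c j | c j. True} \<Longrightarrow> N \<subseteq> N' \<Longrightarrow> N' = N"
    by (rule fg_maximal[OF M(1), of "{S c j | c j. True}"], blast, erule F, rule that)
  then obtain c0 j0 where N: "N = S c0 j0" by blast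
  define q0 where "q0 = l ^ j0"
  have q0: "q0 > 0" using l by (simp add: q0_def)
  \<comment> \<open>Passing to a smaller class inside that of \<open>c0\<close> can only enlarge the
    submodule of vanishing elements; maximality of \<open>N\<close> means that nothing is
    gained.\<close>
  have stable: "zero_on q0 c0 b" if "b \<in> M" "j0 \<le> j" "c mod q0 = c0 mod q0" "zero_on (l ^ j) c b" for b c j
  proof -
    have "N \<subseteq> S c j"
      unfolding N S_def using zero_on_dvd[of q0 c0 _ "l ^ j" c] that(2,3)
      by (auto simp: q0_def le_imp_power_dvd)
    then have "S c j = N" by (intro Nmax) auto
    then show ?thesis using that(1,4) by (auto simp: N S_def q0_def)
  qed
  \<comment> \<open>With \<open>K = k ^ q0\<close> it suffices to treat \<open>k ^ i * n + r\<close>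
    with \<open>n\<close> in the class of \<open>c0\<close>. These numbers either all miss the class
    of \<open>\<rho>\<close> modulo \<open>q0\<close>, or the section of \<open>b\<close> at
    \<open>r\<close> vanishes almost everywhere on a class refining that of \<open>c0\<close>, where
    \<open>stable\<close> applies.\<close>
  have base: "zero_on q0 \<rho> b" if b: "b \<in> M" and j: "j0 \<le> j" and z: "zero_on (l ^ j) \<rho> b" for b j \<rho>
    unfolding zero_on_def
  proof (rule null_by_prefixes[OF q0])
    have "q0 < 2 ^ q0" by (rule less_exp)
    also have "2 ^ q0 \<le> k ^ q0" using k by (intro power_mono) auto
    finally show "q0 \<le> k ^ q0" by simp
    fix t
    define i where "i = q0 * t"
    have ki: "(k ^ q0) ^ t = k ^ i" by (simp add: i_def power_mult)
    let ?Z = "{n \<in> {n. n mod q0 = \<rho> mod q0 \<and> b n \<noteq> 0}. (n div (k ^ q0) ^ t) mod q0 = c0 mod q0}"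
    show "null ?Z"
    proof (rule null_split[of "k ^ i"])
      show "k ^ i > 0" using k by simp
      fix r assume r: "r < k ^ i"
      then have dv: "(k ^ i * n + r) div k ^ i = n" for n using div_mult_self4[of "k ^ i" n r] k by simp
      show "null {n. k ^ i * n + r \<in> ?Z}"
      proof (cases "(k ^ i * c0 + r) mod q0 = \<rho> mod q0")
        case False
        have "n mod q0 \<noteq> c0 mod q0 \<or> (k ^ i * n + r) mod q0 \<noteq> \<rho> mod q0" for n
          using False affine_mod_eq[of n q0 c0 "k ^ i" r] by auto
        then show ?thesis by (intro null_subset[OF null_empty]) (auto simp: ki dv)
      next
        case True
        have cop': "coprime (k ^ i) (l ^ j)" using cop by simp
        obtain c where c: "c mod q0 = c0 mod q0" "(k ^ i * c + r) mod l ^ j = \<rho> mod l ^ j"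
          using coprime_residue_lift[OF cop' _ _ True] j l by (auto simp: q0_def le_imp_power_dvd)
        let ?b = "\<lambda>n. b (k ^ i * n + r)"
        have "?b \<in> M" by (rule kclosed_power[OF M(2) b r])
        moreover have "zero_on (l ^ j) c ?b"
          unfolding zero_on_def
        proof (rule null_subset[OF null_affine[OF z[unfolded zero_on_def], of "k ^ i" r]])
          show "{n. n mod l ^ j = c mod l ^ j \<and> ?b n \<noteq> 0}
            \<subseteq> {n. k ^ i * n + r \<in> {n. n mod l ^ j = \<rho> mod l ^ j \<and> b n \<noteq> 0}}"
          proof
            fix n assume "n \<in> {n. n mod l ^ j = c mod l ^ j \<and> ?b n \<noteq> 0}"
            then show "n \<in> {n. k ^ i * n + r \<in> {n. n mod l ^ j = \<rho> mod l ^ j \<and> b n \<noteq> 0}}"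
              using affine_mod_eq[of n "l ^ j" c "k ^ i" r] c(2) by simp
          qed
        qed (use k in simp)
        ultimately have "zero_on q0 c0 ?b" using stable[OF _ j c(1)] by blast
        then show ?thesis unfolding zero_on_def by (rule null_subset) (auto simp: ki dv)
      qed
    qed
  qed
  \<comment> \<open>From \<open>M\<close> to sequences with sections in \<open>M\<close>:
    \<open>base\<close> is applied to each section that meets the class of \<open>\<rho>\<close>, at
    the class it induces.\<close>
  have "\<And>A i j \<rho>. (\<And>r. r < k ^ i \<Longrightarrow> (\<lambda>n. A (k ^ i * n + r)) \<in> M) \<Longrightarrow> j0 \<le> j \<Longrightarrow>
    zero_on (l ^ j) \<rho> A \<Longrightarrow> zero_on q0 \<rho> A"
  proof -
    fix A i j \<rho>
    assume AM: "\<And>r. r < k ^ i \<Longrightarrow> (\<lambda>n. A (k ^ i * n + r)) \<in> M" and j: "j0 \<le> j" and z: "zero_on (l ^ j) \<rho> A"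
    show "zero_on q0 \<rho> A"
      unfolding zero_on_def
    proof (rule null_split[of "k ^ i"])
      show "k ^ i > 0" using k by simp
      fix r assume r: "r < k ^ i"
      let ?S = "{n. k ^ i * n + r \<in> {n. n mod q0 = \<rho> mod q0 \<and> A n \<noteq> 0}}"
      show "null ?S"
      proof (cases "?S = {}")
        case True
        then show ?thesis by (simp only: null_empty)
      next
        case False
        then obtain n1 where n1: "(k ^ i * n1 + r) mod q0 = \<rho> mod q0" by auto
        have cop': "coprime (k ^ i) (l ^ j)" using cop by simp
        obtain c where c: "c mod q0 = n1 mod q0" "(k ^ i * c + r) mod l ^ j = \<rho> mod l ^ j"
          using coprime_residue_lift[OF cop' _ _ n1] j l by (auto simp: q0_def le_imp_power_dvd)
        let ?b = "\<lambda>n. A (k ^ i * n + r)"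
        have "zero_on (l ^ j) c ?b"
          unfolding zero_on_def
        proof (rule null_subset[OF null_affine[OF z[unfolded zero_on_def], of "k ^ i" r]])
          show "{n. n mod l ^ j = c mod l ^ j \<and> ?b n \<noteq> 0}
            \<subseteq> {n. k ^ i * n + r \<in> {n. n mod l ^ j = \<rho> mod l ^ j \<and> A n \<noteq> 0}}"
          proof
            fix n assume "n \<in> {n. n mod l ^ j = c mod l ^ j \<and> ?b n \<noteq> 0}"
            then show "n \<in> {n. k ^ i * n + r \<in> {n. n mod l ^ j = \<rho> mod l ^ j \<and> A n \<noteq> 0}}"
              using affine_mod_eq[of n "l ^ j" c "k ^ i" r] c(2) by simp
          qed
        qed (use k in simp)
        from base[OF AM[OF r] j this] have "null {n. n mod q0 = c mod q0 \<and> ?b n \<noteq> 0}"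
          by (simp only: zero_on_def)
        moreover have "?S \<subseteq> {n. n mod q0 = c mod q0 \<and> ?b n \<noteq> 0}"
        proof
          fix n assume "n \<in> ?S"
          moreover have "coprime (k ^ i) q0" using cop by (simp add: q0_def)
          ultimately show "n \<in> {n. n mod q0 = c mod q0 \<and> ?b n \<noteq> 0}"
            using residue_cancel[of "k ^ i" q0 n r n1] n1 c(1) by simp
        qed
        ultimately show ?thesis by (rule null_subset)
      qed
    qed
  qed
  then show ?thesis unfolding q0_def by (rule that)
qed

section \<open>Annihilating polynomials\<close>

text \<open>Coefficients are complex so that division with remainder and roots are
  available.\<close>

definition killed :: "complex poly \<Rightarrow> (nat \<Rightarrow> int) \<Rightarrow> bool"
  where "killed P b \<longleftrightarrow> null {n. shift_poly P (\<lambda>n. of_int (b n)) n \<noteq> 0}"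

lemma null_shift_poly:
  assumes "null {n. y n \<noteq> 0}"
  shows "null {n. shift_poly P y n \<noteq> 0}"
proof -
  have "null {n. 1 * n + i \<in> {n. y n \<noteq> 0}}" for i using assms by (intro null_affine) auto
  then have "null (\<Union>i\<le>degree P. {n. y (n + i) \<noteq> 0})" by (intro null_UN) auto
  then show ?thesis by (rule null_subset) (auto simp: shift_poly_def intro: sum.neutral)
qed

lemma killed_mult: "killed P b \<Longrightarrow> killed (Q * P) b"
  unfolding killed_def shift_poly_mult by (rule null_shift_poly)

lemma killed_dvd: "P dvd Q \<Longrightarrow> killed P b \<Longrightarrow> killed Q b"
  by (metis dvdE killed_mult mult.commute)

lemma killed_diff: "killed P b \<Longrightarrow> killed Q b \<Longrightarrow> killed (P - Q) b"
  unfolding killed_def by (erule (1) null_pointwise2) (auto simp: shift_poly_diff)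

lemma killed_linear:
  assumes "killed P x" "killed P y"
  shows "killed P (seq_scale c x + y)"
proof -
  have eq: "shift_poly P (\<lambda>n. of_int ((seq_scale c x + y) n)) n
      = of_int c * shift_poly P (\<lambda>n. of_int (x n)) n + shift_poly P (\<lambda>n. of_int (y n)) n" for n
    using shift_poly_linear[of P "of_int c" "\<lambda>n. of_int (x n)" "\<lambda>n. of_int (y n)" n] by (simp add: seq_scale_def)
  from assms show ?thesis
    unfolding killed_def by (rule null_pointwise2) (simp only: eq, auto)
qed

lemma killed_zero: "killed P 0"
  by (simp add: killed_def shift_poly_def null_empty)

lemma killed_span:
  assumes "b \<in> int_seq.span G" "\<And>g. g \<in> G \<Longrightarrow> killed P g"
  shows "killed P b"
  using assms(1)
  by (induction b rule: int_seq.span_induct_alt)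
    (rule killed_zero, rule killed_linear, erule assms(2), assumption)

lemma common_killer:
  assumes "fg M" "\<And>b. b \<in> M \<Longrightarrow> \<exists>P. P \<noteq> 0 \<and> killed P b"
  obtains P where "P \<noteq> 0" "\<And>b. b \<in> M \<Longrightarrow> killed P b"
proof -
  obtain G where G: "finite G" "M = int_seq.span G" using assms(1) unfolding fg_def by blast
  have "\<exists>P. P \<noteq> 0 \<and> killed P g" if "g \<in> G" for g using that assms(2) G(2) int_seq.span_base by blast
  then obtain f where f: "\<And>g. g \<in> G \<Longrightarrow> f g \<noteq> 0 \<and> killed (f g) g" by metis
  have "killed (\<Prod>g\<in>G. f g) b" if "b \<in> M" for b
    using that unfolding G(2)
  proof (rule killed_span)
    fix g assume "g \<in> G"
    then show "killed (\<Prod>g\<in>G. f g) g" using f G(1) by (meson dvd_prodI killed_dvd)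
  qed
  moreover have "(\<Prod>g\<in>G. f g) \<noteq> 0" using f G(1) by simp
  ultimately show ?thesis using that by blast
qed

text \<open>Raising to the power \<open>k\<close> maps the finite set of roots to itself, so the
  iterates of a root repeat; as 0 is not a root, every root is a root of unity. A common exponent
  \<open>q\<close> and the univariate Nullstellensatz give the divisibility.\<close>

lemma dvd_root_of_unity_power:
  fixes P :: "complex poly"
  assumes "k \<ge> 2" "P \<noteq> 0" "poly P 0 \<noteq> 0" "\<And>z. poly P z = 0 \<Longrightarrow> poly P (z ^ k) = 0"
  obtains q where "q > 0" "P dvd (monom 1 q - 1) ^ degree P"
proof -
  let ?R = "{z. poly P z = 0}"
  have fin: "finite ?R" using assms(2) by (rule poly_roots_finite)
  have "\<exists>s>0. z ^ s = 1" if z: "z \<in> ?R" for z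
  proof -
    have "z ^ (k ^ t) \<in> ?R" for t
    proof (induction t)
      case (Suc t)
      then show ?case using assms(4)[of "z ^ (k ^ t)"] by (simp add: power_mult mult.commute flip: power_mult)
    qed (use z in simp)
    then have "finite (range (\<lambda>t. z ^ (k ^ t)))" by (intro finite_subset[OF _ fin]) auto
    then have "\<not> inj (\<lambda>t. z ^ (k ^ t))" using finite_imageD infinite_UNIV_nat by blast
    then obtain t t' where t: "z ^ (k ^ t) = z ^ (k ^ t')" "t < t'"
      unfolding inj_def by (metis linorder_neqE_nat)
    have lt: "k ^ t < k ^ t'" using t(2) assms(1) by simp
    have z0: "z \<noteq> 0" using z assms(3) by auto
    have "z ^ (k ^ t' - k ^ t) * z ^ (k ^ t) = z ^ (k ^ t' - k ^ t + k ^ t)"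
      by (simp only: power_add)
    also have "\<dots> = z ^ (k ^ t)" using lt t(1) by simp
    finally have "z ^ (k ^ t' - k ^ t) = 1" using z0 by simp
    then show ?thesis using lt by (intro exI[of _ "k ^ t' - k ^ t"]) simp
  qed
  then obtain s where s: "\<And>z. z \<in> ?R \<Longrightarrow> s z > 0 \<and> z ^ s z = 1" by metis
  define q where "q = (\<Prod>z\<in>?R. s z)"
  have q0: "q > 0" unfolding q_def using s by (intro prod_pos) auto
  have "poly (monom 1 q - 1) z = 0" if "poly P z = 0" for z
  proof -
    have "s z dvd q" unfolding q_def using that fin by (intro dvd_prodI) auto
    then obtain d where "q = s z * d" by blast
    then show ?thesis using s[of z] that by (simp add: poly_monom power_mult)
  qed
  then have "P dvd (monom 1 q - 1) ^ degree P"
    using nullstellensatz_univariate[of P "monom 1 q - 1"] assms(2) by blast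
  with q0 show ?thesis using that by blast
qed

text \<open>The common annihilators of \<open>M\<close> form an ideal generated by one of minimal
  degree, \<open>P\<close>. It divides \<open>P(X^k)\<close>, which confines its roots to roots of
  unity.\<close>

lemma killed_imp_asymp_diffq_nilpotent:
  assumes k: "k \<ge> 2" and M: "kclosed k M"
    and P0: "P0 \<noteq> 0" "\<And>b. b \<in> M \<Longrightarrow> killed P0 b"
  obtains q m where "q > 0" "\<And>b. b \<in> M \<Longrightarrow> (diffq q ^^ m) b \<simeq> 0"
proof -
  let ?I = "\<lambda>P. P \<noteq> 0 \<and> (\<forall>b\<in>M. killed P b)"
  obtain P where P: "?I P" and min: "\<And>Q. ?I Q \<Longrightarrow> degree P \<le> degree Q"
    using ex_has_least_nat[of ?I P0 degree] P0 by blast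
  have dvd: "P dvd Q" if "\<And>b. b \<in> M \<Longrightarrow> killed Q b" for Q
  proof (rule ccontr)
    assume "\<not> P dvd Q"
    then have nz: "Q mod P \<noteq> 0" by (simp add: dvd_eq_mod_eq_0)
    have "Q mod P = Q - (Q div P) * P" by (simp add: minus_div_mult_eq_mod)
    then have "\<forall>b\<in>M. killed (Q mod P) b" using P that by (metis killed_diff killed_mult)
    with nz have "degree P \<le> degree (Q mod P)" by (intro min) blast
    then show False using degree_mod_less[of P Q] P nz by simp
  qed
  \<comment> \<open>If \<open>X\<close> divided \<open>P\<close>, the quotient would annihilate
    \<open>M\<close> too, because a shift by one preserves density zero; this contradicts
    minimality.\<close>
  have "poly P 0 \<noteq> 0"
  proof
    assume "poly P 0 = 0"
    then obtain Q where Q: "P = [:0, 1:] * Q" by (metis dvdE minus_zero poly_eq_0_iff_dvd)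
    then have Q0: "Q \<noteq> 0" using P by auto
    have "killed Q b" if "b \<in> M" for b
    proof -
      have "shift_poly P (\<lambda>n. of_int (b n)) n = shift_poly Q (\<lambda>n. of_int (b n)) (Suc n)" for n
        unfolding Q by (simp add: shift_poly_pCons)
      moreover have "killed P b" using P that by blast
      ultimately have "null {n. Suc n \<in> {n. shift_poly Q (\<lambda>n. of_int (b n)) n \<noteq> 0}}"
        by (simp add: killed_def)
      then show ?thesis unfolding killed_def by (rule null_unshift)
    qed
    then have "degree P \<le> degree Q" using Q0 by (intro min) blast
    moreover have "degree P = Suc (degree Q)" using Q Q0 by simp
    ultimately show False by simp
  qed
  moreover have "poly P (z ^ k) = 0" if "poly P z = 0" for z
  proof -
    \<comment> \<open>On each class modulo \<open>k\<close> this operator acts as \<open>P\<close>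
      on a section of \<open>b\<close>, and that section lies in \<open>M\<close>.\<close>
    have "killed (pcompose P (monom 1 k)) b" if b: "b \<in> M" for b
      unfolding killed_def
    proof (rule null_split[of k])
      fix r assume "r < k"
      then have "(\<lambda>n. b (k * n + r)) \<in> M" by (rule kclosedD[OF M b])
      then have "killed P (\<lambda>n. b (k * n + r))" using P by blast
      then show "null {n. k * n + r \<in> {n. shift_poly (pcompose P (monom 1 k)) (\<lambda>n. of_int (b n)) n \<noteq> 0}}"
        by (simp add: killed_def shift_poly_pcompose_monom)
    qed (use k in simp)
    then have "P dvd pcompose P (monom 1 k)" by (rule dvd)
    then have "poly (pcompose P (monom 1 k)) z = 0" using that by (metis dvdE mult_zero_left poly_mult)
    then show ?thesis by (simp add: poly_pcompose poly_monom)
  qed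
  ultimately obtain q where q: "q > 0" "P dvd (monom 1 q - 1) ^ degree P"
    using dvd_root_of_unity_power[OF k] P by metis
  have "(diffq q ^^ degree P) b \<simeq> 0" if "b \<in> M" for b
  proof -
    have "killed ((monom 1 q - 1) ^ degree P) b" using killed_dvd[OF q(2)] P that by blast
    moreover have "(diffq q ^^ m) (\<lambda>n. of_int (b n) :: complex) = (\<lambda>n. of_int ((diffq q ^^ m) b n))" for m
      by (induction m) (auto simp: diffq_def)
    ultimately show ?thesis by (simp add: killed_def asymp_eq_iff_null flip: funpow_diffq_shift_poly)
  qed
  with q(1) show ?thesis using that by blast
qed

text \<open>A linear relation modulo \<open>\<simeq>\<close> makes a combination \<open>A\<close> of
  translates of \<open>a\<close> vanish along classes modulo \<open>l ^ j\<close>;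
  \<open>stable_modulus\<close> spreads this to almost all arguments, and the coefficients of
  \<open>A\<close> give the annihilator.\<close>

lemma kernel_killed:
  assumes k: "k \<ge> 2" and l: "l \<ge> 2" and cop: "coprime k l"
    and reg: "k_regular k a" and asy: "asymp_k_regular l a" and r: "r < k ^ i"
  shows "\<exists>P. P \<noteq> 0 \<and> killed P (\<lambda>n. a (k ^ i * n + r))"
proof -
  obtain G where G: "finite G" "k_kernel_module k a = int_seq.span G"
    using reg unfolding k_regular_def by blast
  \<comment> \<open>Translates by 0 and 1 of the kernel elements: this admits offsets up to
    \<open>2 * k ^ j\<close>, which the translates inside \<open>A\<close> will need.\<close>
  define M where "M = int_seq.span (affine_subseqs G 1 1)"
  have fM: "fg M" unfolding fg_def M_def using finite_affine_subseqs[OF G(1)] by blast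
  have kM: "kclosed k M"
    unfolding M_def using k kclosed_k_kernel_module[of k a] by (intro kclosed_affine_subseqs) (auto simp: G(2))
  have aM: "(\<lambda>n. a (k ^ j * n + s)) \<in> M" if "s < 2 * k ^ j" for j s
  proof -
    let ?s = "s mod k ^ j"
    have "(\<lambda>n. a (k ^ j * n + ?s)) \<in> k_kernel k a"
      unfolding k_kernel_def mem_Collect_eq
      by (intro exI[of _ j] exI[of _ ?s] conjI refl) (use k in simp)
    then have "(\<lambda>n. a (k ^ j * n + ?s)) \<in> int_seq.span G"
      unfolding G(2)[symmetric] k_kernel_module_def by (rule int_seq.span_base)
    moreover have "s div k ^ j \<le> 1" using that k by (simp add: less_mult_imp_div_less less_Suc_eq_le[symmetric])
    ultimately have "(\<lambda>n. a (k ^ j * (1 * n + s div k ^ j) + ?s)) \<in> M"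
      unfolding M_def by (rule affine_subseqs_span)
    moreover have "k ^ j * (1 * n + s div k ^ j) + ?s = k ^ j * n + s" for n
      by (simp add: distrib_left add.assoc)
    ultimately show ?thesis by simp
  qed
  obtain j0 where j0: "\<And>A i j \<rho>. (\<And>r. r < k ^ i \<Longrightarrow> (\<lambda>n. A (k ^ i * n + r)) \<in> M) \<Longrightarrow> j0 \<le> j \<Longrightarrow>
    zero_on (l ^ j) \<rho> A \<Longrightarrow> zero_on (l ^ j0) \<rho> A"
    using stable_modulus[OF k _ cop fM kM] l by auto
  define q0 where "q0 = l ^ j0"
  have q0: "q0 > 0" using l by (simp add: q0_def)
  obtain B where B: "finite B" "\<And>b. b \<in> k_kernel_module l a \<Longrightarrow> \<exists>c\<in>int_seq.span B. b \<simeq> c"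
    using asy unfolding asymp_k_regular_iff by blast
  \<comment> \<open>The factor \<open>k ^ i\<close> turns a translation of \<open>a\<close> by
    \<open>\<sigma>\<close> into a translation by \<open>q0\<close> of the section modulo
    \<open>k ^ i\<close>.\<close>
  define \<sigma> where "\<sigma> = k ^ i * q0"
  \<comment> \<open>One equation for each pair of a residue \<open>\<rho> < q0\<close> and a
    generator in \<open>B\<close>; the \<open>d + 1\<close> coefficients then admit one nonzero
    relation valid for all \<open>\<rho>\<close> at once.\<close>
  define d where "d = card ({..<q0} \<times> B)"
  \<comment> \<open>Large enough that every \<open>\<rho> + \<sigma> * h\<close> is a residue below
    \<open>l ^ j\<close>, and at least \<open>j0\<close>.\<close>
  define j where "j = j0 + (q0 + \<sigma> * d)"
  have "q0 + \<sigma> * d \<le> j" by (simp add: j_def)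
  also have "j < 2 ^ j" by (rule less_exp)
  also have "2 ^ j \<le> l ^ j" using l by (intro power_mono) auto
  finally have lj: "q0 + \<sigma> * d < l ^ j" .
  have "\<exists>u. (\<lambda>n. a (l ^ j * n + (\<rho> + \<sigma> * h))) \<simeq> (\<lambda>n. \<Sum>g\<in>B. u g * g n)" if "\<rho> < q0" "h \<le> d" for \<rho> h
  proof -
    have "\<sigma> * h \<le> \<sigma> * d" using that(2) by simp
    then have "\<rho> + \<sigma> * h < l ^ j" using lj that(1) by linarith
    then have "(\<lambda>n. a (l ^ j * n + (\<rho> + \<sigma> * h))) \<in> k_kernel_module l a"
      unfolding k_kernel_module_def by (intro int_seq.span_base) (auto simp: k_kernel_def)
    from B(2)[OF this] obtain c where c: "c \<in> int_seq.span B" "(\<lambda>n. a (l ^ j * n + (\<rho> + \<sigma> * h))) \<simeq> c" by blast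
    from c(1) obtain u where u: "c = (\<Sum>g\<in>B. seq_scale (u g) g)"
      using int_seq.span_finite[OF B(1)] by auto
    have "(\<Sum>g\<in>B'. seq_scale (u g) g) n = (\<Sum>g\<in>B'. u g * g n)" if "finite B'" for B' n
      using that by (induction B' rule: finite_induct) (auto simp: seq_scale_def)
    then have "c = (\<lambda>n. \<Sum>g\<in>B. u g * g n)" using u B(1) by auto
    then show ?thesis using c(2) by blast
  qed
  note ex = this
  define u where "u \<rho> h = (SOME u. (\<lambda>n. a (l ^ j * n + (\<rho> + \<sigma> * h))) \<simeq> (\<lambda>n. \<Sum>g\<in>B. u g * g n))" for \<rho> h
  have u: "(\<lambda>n. a (l ^ j * n + (\<rho> + \<sigma> * h))) \<simeq> (\<lambda>n. \<Sum>g\<in>B. u \<rho> h g * g n)"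
    if "\<rho> < q0" "h \<le> d" for \<rho> h
    unfolding u_def by (rule someI_ex[OF ex[OF that]])
  obtain c where c: "\<exists>h\<in>{..d}. c h \<noteq> 0"
    "\<forall>x\<in>{..<q0} \<times> B. (\<Sum>h\<in>{..d}. c h * u (fst x) h (snd x)) = 0"
    using underdetermined_int_system[of "{..<q0} \<times> B" "{..d}" "\<lambda>h x. u (fst x) h (snd x)"] B(1)
    by (auto simp: d_def)
  define A where "A N = (\<Sum>h\<le>d. c h * a (N + \<sigma> * h))" for N
  have zA: "zero_on (l ^ j) \<rho> A" if \<rho>: "\<rho> < q0" for \<rho>
  proof -
    have "(\<lambda>n. \<Sum>h\<le>d. c h * a (l ^ j * n + (\<rho> + \<sigma> * h))) \<simeq> (\<lambda>n. \<Sum>h\<le>d. c h * (\<Sum>g\<in>B. u \<rho> h g * g n))"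
      by (rule asymp_eq_sum) (use u \<rho> in auto)
    moreover have "(\<Sum>h\<le>d. c h * (\<Sum>g\<in>B. u \<rho> h g * g n)) = 0" for n
    proof -
      have "(\<Sum>h\<le>d. c h * (\<Sum>g\<in>B. u \<rho> h g * g n)) = (\<Sum>g\<in>B. (\<Sum>h\<le>d. c h * u \<rho> h g) * g n)"
        by (simp add: sum_distrib_left sum_distrib_right mult.assoc) (rule sum.swap)
      also have "\<dots> = 0" using c(2) \<rho> by (intro sum.neutral) auto
      finally show ?thesis .
    qed
    ultimately have z: "null {n. A (l ^ j * n + \<rho>) \<noteq> 0}"
      by (simp add: asymp_eq_iff_null A_def add.assoc)
    show ?thesis
      unfolding zero_on_def
    proof (rule null_split[of "l ^ j"])
      fix t assume "t < l ^ j"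
      moreover have "\<rho> < l ^ j" using \<rho> lj by linarith
      ultimately show "null {n. l ^ j * n + t \<in> {n. n mod l ^ j = \<rho> mod l ^ j \<and> A n \<noteq> 0}}"
        by (intro null_subset[OF z]) auto
    qed (use l in simp)
  qed
  \<comment> \<open>Chosen so that \<open>s + \<sigma> * h\<close> stays below
    \<open>2 * k ^ i'\<close>, the range of offsets covered by \<open>aM\<close>.\<close>
  define i' where "i' = \<sigma> * d"
  have "\<sigma> * d < 2 ^ i'" unfolding i'_def by (rule less_exp)
  also have "2 ^ i' \<le> k ^ i'" using k by (intro power_mono) auto
  finally have ki': "\<sigma> * d < k ^ i'" .
  have AM: "(\<lambda>n. A (k ^ i' * n + s)) \<in> M" if s: "s < k ^ i'" for s
  proof -
    have "(\<Sum>h\<le>d. seq_scale (c h) (\<lambda>n. a (k ^ i' * n + (s + \<sigma> * h)))) \<in> M"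
    proof (intro int_seq.subspace_sum[OF fg_subspace[OF fM]] int_seq.subspace_scale[OF fg_subspace[OF fM]])
      fix h assume "h \<in> {..d}"
      then have "\<sigma> * h \<le> \<sigma> * d" by simp
      then show "(\<lambda>n. a (k ^ i' * n + (s + \<sigma> * h))) \<in> M" using ki' s by (intro aM) linarith
    qed
    moreover have "(\<Sum>h\<le>e. seq_scale (c h) (\<lambda>n. a (k ^ i' * n + (s + \<sigma> * h)))) n
        = (\<Sum>h\<le>e. c h * a (k ^ i' * n + s + \<sigma> * h))" for e n
      by (induction e) (auto simp: seq_scale_def add.assoc)
    then have "(\<Sum>h\<le>d. seq_scale (c h) (\<lambda>n. a (k ^ i' * n + (s + \<sigma> * h)))) = (\<lambda>n. A (k ^ i' * n + s))"
      by (auto simp: A_def)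
    ultimately show ?thesis by simp
  qed
  have j_ge: "j0 \<le> j" by (simp add: j_def)
  \<comment> \<open>The residues below \<open>q0\<close> exhaust all classes modulo
    \<open>q0\<close>, so \<open>A\<close> vanishes almost everywhere.\<close>
  have "zero_on q0 \<rho> A" if "\<rho> < q0" for \<rho>
    unfolding q0_def by (rule j0[where i = i'], erule AM, rule j_ge, rule zA[OF that])
  then have "null (\<Union>\<rho><q0. {n. n mod q0 = \<rho> mod q0 \<and> A n \<noteq> 0})" by (intro null_UN) (auto simp: zero_on_def)
  then have nA: "null {n. A n \<noteq> 0}"
    by (rule null_subset) (use q0 in \<open>auto intro!: bexI[of _ "_ mod q0"]\<close>)
  define P :: "complex poly" where "P = (\<Sum>h\<le>d. monom (of_int (c h)) (q0 * h))"
  obtain h where h: "h \<le> d" "c h \<noteq> 0" using c(1) by auto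
  \<comment> \<open>The exponents \<open>q0 * h\<close> are distinct because \<open>q0 > 0\<close>,
    so no coefficients merge.\<close>
  have "coeff P (q0 * h) = (\<Sum>h'\<le>d. if h' = h then of_int (c h') else 0)"
    unfolding P_def coeff_sum using q0 by (intro sum.cong) auto
  then have "coeff P (q0 * h) \<noteq> 0" using h by simp
  then have "P \<noteq> 0" by auto
  moreover have "killed P (\<lambda>n. a (k ^ i * n + r))"
  proof -
    have "shift_poly P (\<lambda>n. of_int (a (k ^ i * n + r))) n = of_int (A (k ^ i * n + r))" for n
      by (simp add: P_def shift_poly_sum shift_poly_monom A_def \<sigma>_def algebra_simps)
    then show ?thesis
      using null_affine[OF nA, of "k ^ i" r] k by (simp add: killed_def)
  qed
  ultimately show ?thesis by blast
qed

lemma module_killed: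
  assumes k: "k \<ge> 2" and l: "l \<ge> 2" and cop: "coprime k l"
    and reg: "k_regular k a" and asy: "asymp_k_regular l a" and b: "b \<in> k_kernel_module k a"
  shows "\<exists>P. P \<noteq> 0 \<and> killed P b"
  using b unfolding k_kernel_module_def
proof (induction b rule: int_seq.span_induct_alt)
  case base
  show ?case by (rule exI[of _ 1], rule conjI, simp, rule killed_zero)
next
  case (step c x y)
  from step.hyps obtain P where P: "P \<noteq> 0" "killed P x"
    using kernel_killed[OF k l cop reg asy] unfolding k_kernel_def by blast
  obtain Q where Q: "Q \<noteq> 0" "killed Q y" using step.IH by blast
  have "killed (P * Q) (seq_scale c x + y)"
    using killed_mult[OF P(2), of Q] killed_mult[OF Q(2), of P] by (intro killed_linear) (simp_all add: mult.commute)
  moreover have "P * Q \<noteq> 0" using P(1) Q(1) by simp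
  ultimately show ?case by blast
qed

theorem theorem7p2:
  fixes k l :: nat and a :: "nat \<Rightarrow> int"
  assumes "k \<ge> 2" and "l \<ge> 2" and "coprime k l"
    and "k_regular k a" and "asymp_k_regular l a"
  shows "\<exists>a'. k_regular k a' \<and> satisfies_linear_recurrence a' \<and> a \<simeq> a'"
proof -
  let ?M = "k_kernel_module k a"
  have "fg ?M" using assms(4) unfolding k_regular_def fg_def by metis
  then obtain P where P: "P \<noteq> 0" "\<And>b. b \<in> ?M \<Longrightarrow> killed P b"
    using common_killer module_killed[OF assms] by metis
  obtain q m where q: "q > 0" "\<And>b. b \<in> ?M \<Longrightarrow> (diffq q ^^ m) b \<simeq> 0"
    using killed_imp_asymp_diffq_nilpotent[OF assms(1) kclosed_k_kernel_module P] by metis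
  have "a \<in> ?M" unfolding k_kernel_module_def by (rule int_seq.span_base[OF self_in_k_kernel])
  moreover have "bireg k l a" using assms by (intro bireg_if_regular) auto
  ultimately obtain m' a' where a': "a' \<in> quasi_poly q m'" "a \<simeq> a'"
    using asymp_quasi_poly[OF assms(1-3) q(1)] q(2) by blast
  have "k_regular k a'" using kreg_quasi_poly[OF q(1) a'(1)] by (simp add: k_regular_iff_kreg)
  moreover have "satisfies_linear_recurrence a'" by (rule quasi_poly_linear_recurrence[OF q(1) a'(1)])
  ultimately show ?thesis using a'(2) by blast
qed

end
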